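(* Let $\gamma>0$, $\alpha\ge0$, $\mu,\nu$ as in the context with $\mu\ge1$, let $\delta\in[0,\tfrac12]$, and let $\lambda$ be a non-negative integrable function on $[0,1]$ with $\int_0^1\lambda=1$. Suppose $\Lambda_\nu$ and $\Pi_{\mu,\nu}$ are integrable on $[0,1]$ and positive on $(0,1)$, that $t^{1/\nu}\Lambda_\nu(t)\to0$ and $t^{1/\nu}\Pi_{\mu,\nu}(t)\to0$ as $t\to0^+$, and that $$t\mapsto\frac{-t\,\Pi_{\mu,\nu}'(t)+\left(1-\frac1\mu\right)\Pi_{\mu,\nu}(t)}{(1+t)(1-t)^{1+2\delta}}$$ is decreasing on $(0,1)$. If $\beta<1$ satisfies $\frac{\beta-\frac12}{1-\beta}=-\int_0^1\lambda(t)q(t)\,dt$, then $V_\lambda(f)\in K(\delta)$ for every $f\in\mathcal W_\beta(\alpha,\gamma)$.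
   Context: $E=\{z:|z|<1\}$; $\mathcal A$ = analytic $f$ on $E$ with $f(0)=f'(0)-1=0$; $K(\delta)=\{f\in\mathcal A:\mathrm{Re}(1+zf''/f')>\delta \text{ on } E\}$. $\mathcal W_\beta(\alpha,\gamma)$ ($\alpha,\gamma\ge0,\beta<1$) is the set of $f\in\mathcal A$ such that for some $\phi\in\mathbb R$, $\mathrm{Re}\,e^{i\phi}\big((1-\alpha+2\gamma)\frac{f(z)}z+(\alpha-2\gamma)f'(z)+\gamma zf''(z)-\beta\big)>0$ on $E$. $V_\lambda(f)(z)=\int_0^1\lambda(t)\frac{f(tz)}tdt$. $\mu,\nu>0$ satisfy $\mu+\nu=\alpha-\gamma$, $\mu\nu=\gamma$. $q(t)=\frac1{\mu\nu}\int_0^1\int_0^1\frac{(1-\delta)-(1+\delta)swt}{(1-\delta)(1+swt)^3}s^{1/\mu-1}w^{1/\nu-1}ds\,dw$. $\Lambda_\nu(t)=\int_t^1\lambda(x)x^{-1/\nu}dx$, $\Pi_{\mu,\nu}(t)=\int_t^1\Lambda_\nu(x)x^{1/\nu-1-1/\mu}dx$. *)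

theory Defs
  imports "HOL-Analysis.Analysis"
begin

definition unit_disc :: "complex set" where
  "unit_disc = ball 0 1"

definition class_A :: "(complex \<Rightarrow> complex) set" where
  "class_A = {f. f holomorphic_on unit_disc \<and> f 0 = 0 \<and> deriv f 0 = 1}"

text \<open>K(delta): Re(1 + z f''/f') > delta on E (the quotient presupposes f' nonzero on E).\<close>
definition class_K :: "real \<Rightarrow> (complex \<Rightarrow> complex) set" where
  "class_K \<delta> = {f \<in> class_A. \<forall>z\<in>unit_disc. deriv f z \<noteq> 0 \<and>
      Re (1 + z * deriv (deriv f) z / deriv f z) > \<delta>}"

text \<open>f(z)/z, extended analytically at z = 0 by its limit f'(0).\<close>
definition quot_z :: "(complex \<Rightarrow> complex) \<Rightarrow> complex \<Rightarrow> complex" where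
  "quot_z f z = (if z = 0 then deriv f 0 else f z / z)"

definition class_W :: "real \<Rightarrow> real \<Rightarrow> real \<Rightarrow> (complex \<Rightarrow> complex) set" where
  "class_W \<beta> \<alpha> \<gamma> = {f \<in> class_A. \<exists>\<phi>::real. \<forall>z\<in>unit_disc.
      Re (cis \<phi> * (of_real (1 - \<alpha> + 2*\<gamma>) * quot_z f z + of_real (\<alpha> - 2*\<gamma>) * deriv f z
                  + of_real \<gamma> * z * deriv (deriv f) z - of_real \<beta>)) > 0}"

definition V_op :: "(real \<Rightarrow> real) \<Rightarrow> (complex \<Rightarrow> complex) \<Rightarrow> complex \<Rightarrow> complex" where
  "V_op lam f z = integral {0..1} (\<lambda>t. of_real (lam t) * f (of_real t * z) / of_real t)"

definition q_fun :: "real \<Rightarrow> real \<Rightarrow> real \<Rightarrow> real \<Rightarrow> real" where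
  "q_fun \<mu> \<nu> \<delta> t = (1 / (\<mu> * \<nu>)) *
     integral {0..1} (\<lambda>w. integral {0..1} (\<lambda>s.
        ((1 - \<delta>) - (1 + \<delta>) * s * w * t) / ((1 - \<delta>) * (1 + s * w * t) ^ 3)
        * s powr (1 / \<mu> - 1) * w powr (1 / \<nu> - 1)))"

definition Lambda_nu :: "real \<Rightarrow> (real \<Rightarrow> real) \<Rightarrow> real \<Rightarrow> real" where
  "Lambda_nu \<nu> lam t = integral {t..1} (\<lambda>x. lam x * x powr (- 1 / \<nu>))"

definition Pi_mu_nu :: "real \<Rightarrow> real \<Rightarrow> (real \<Rightarrow> real) \<Rightarrow> real \<Rightarrow> real" where
  "Pi_mu_nu \<mu> \<nu> lam t = integral {t..1} (\<lambda>x. Lambda_nu \<nu> lam x * x powr (1 / \<nu> - 1 - 1 / \<mu>))"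

end

theory Submission
  imports Defs "HOL-Complex_Analysis.Complex_Analysis"
begin

text \<open>
  Write \<open>H\<close> for the expression defining \<open>W\<^sub>\<beta>(\<alpha>,\<gamma>)\<close> and \<open>F = V\<^sub>\<lambda>(f)\<close>. Then \<open>Re (1 + z F''/F') > \<delta>\<close> says that
  \<open>F' + c z F''\<close> has no zero for \<open>c = (1 + \<epsilon>) / (2 (1 - \<delta>))\<close>, \<open>|\<epsilon>| \<le> 1\<close>. This function is the Hadamard
  product of \<open>H\<close> with \<open>K(z) = \<integral> \<omega>(t) g(tz) dt\<close>, where \<open>g(w) = 1/(1 - w) + c w/(1 - w)\<^sup>2\<close> and
  \<open>\<mu>\<nu> \<omega>(t) = t powr (1/\<mu> - 1) (-t \<Pi>'(t) + (1 - 1/\<mu>) \<Pi>(t))\<close>. Since \<open>Re e\<^sup>i\<^sup>\<phi>(H - \<beta>) > 0\<close>, writing the product as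
  a Fourier integral reduces everything to \<open>Re K(z) > \<integral> \<lambda> q\<close>, and the right-hand side is \<open>K(-1)\<close> for \<open>\<epsilon> = 1\<close>.

  For \<open>w = s e\<^sup>i\<^sup>\<theta>\<close> the quantity \<open>(1 + s)(1 - s) powr (1 + 2\<delta>) (Re g(w) - g\<^sub>1(-s))\<close>, \<open>g\<^sub>1\<close> being \<open>g\<close> for \<open>\<epsilon> = 1\<close>, is at least
  a non-negative multiple of the derivative of
  \<open>s\<^sup>2 (1 - s) powr (2 + 2\<delta>) (1 - \<delta>s/(1 + \<delta>)) / |1 - w|\<^sup>2\<close>, which is non-negative and vanishes at \<open>0\<close>; integrating
  against a decreasing non-negative weight keeps the sign.
\<close>

subsection \<open>The pointwise kernel inequality\<close>

text \<open>The weight is dictated by coefficients. In H the coefficient of z^n is (1 + \<mu> n)(1 +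
  \<nu> n) times that of z^(n+1) in f, because \<mu> + \<nu> = \<alpha> - \<gamma> and \<mu> \<nu> =
  \<gamma>; in F' it is (n + 1) \<open>\<tau> n\<close> times the same number,
  \<open>\<tau> n\<close> being the n-th moment of \<lambda>. So \<open>\<omega>\<close> needs the
  n-th moment (n + 1) \<open>\<tau> n\<close> / ((1 + \<mu> n)(1 + \<nu> n)): the two nested tail
  integrals supply the divisions, the summand with 1 - 1/\<mu> the factor n + 1. The condition on
  \<beta> is exactly critical: a zero of F' + c z F'' would produce equality in the product
  estimate. Hence the bound on Re K must be strict, while the comparison of derivatives only yields
  a weak inequality. It is therefore used against K(-|z|) with \<epsilon> = 1, and strictness comes
  from the monotonicity of the kernel on the negative axis, between -|z| and -1.\<close>

definition conv_kernel :: "'a::real_normed_field \<Rightarrow> 'a \<Rightarrow> 'a" where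
  "conv_kernel c w = 1 / (1 - w) + c * w / (1 - w)\<^sup>2"

text \<open>This is what remains of the kernel comparison after clearing denominators;
  \<open>D\<close> stands for |1 - w|^2 with |w| = s, hence its range. The difference of the two
  sides is D P + ((1 + s)^2 - D) k s (1 - s)^2 with a cubic P in s free of \<open>D\<close>. Since
  P(1) = 4 (\<delta> - k (1 + \<delta>)), the value of \<open>k\<close> is the one for which 1 - s
  splits off.\<close>

lemma kernel_polynomial_ineq:
  fixes s D \<delta> k :: real
  assumes s: "0 \<le> s" "s < 1" and \<delta>: "0 \<le> \<delta>" "\<delta> \<le> 1/2" and D: "0 \<le> D" "D \<le> (1 + s)\<^sup>2"
    and k: "k * (1 + \<delta>) = \<delta>" "0 \<le> k"
  shows "(1 + s) * (D * (1 - (3 + 2 * \<delta>) * s) * (1 - k * s) - D * s * (1 - s) * k + (1 - k * s) * (1 - s)\<^sup>2 * (1 + s))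
    \<le> D * (2 * (1 - \<delta>) * (1 - s\<^sup>2) - 4 * s) + (1 + s)\<^sup>2 * (1 - s)\<^sup>2"
proof -
  define P where "P = (1 - 2 * \<delta>) + s * (-2 + 2 * \<delta> + 3 * k) + s\<^sup>2 * (1 + 4 * \<delta> - k * (4 + 2 * \<delta>)) - k * (3 + 2 * \<delta>) * s^3"
  have "P * (1 + \<delta>) = (1 - s) * ((1 - 2 * \<delta>) * (1 + \<delta> - s) + \<delta> * (3 + 2 * \<delta>) * s\<^sup>2)"
  proof -
    have "P * (1 + \<delta>) = (1 - 2 * \<delta>) * (1 + \<delta>) + s * ((2 * \<delta> - 2) * (1 + \<delta>) + 3 * (k * (1 + \<delta>)))
        + s\<^sup>2 * ((1 + 4 * \<delta>) * (1 + \<delta>) - (k * (1 + \<delta>)) * (4 + 2 * \<delta>)) - (k * (1 + \<delta>)) * (3 + 2 * \<delta>) * s^3"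
      unfolding P_def by algebra
    then show ?thesis unfolding k(1) by algebra
  qed
  \<comment> \<open>The bound \<delta> \<le> 1/2 enters through 1 - 2 \<delta> \<ge> 0.\<close>
  also have "\<dots> \<ge> 0"
    using s \<delta> by (intro mult_nonneg_nonneg add_nonneg_nonneg) auto
  finally have P: "P \<ge> 0" using \<delta> by (simp add: zero_le_mult_iff)
  have "D * (2 * (1 - \<delta>) * (1 - s\<^sup>2) - 4 * s) + (1 + s)\<^sup>2 * (1 - s)\<^sup>2
      - (1 + s) * (D * (1 - (3 + 2 * \<delta>) * s) * (1 - k * s) - D * s * (1 - s) * k + (1 - k * s) * (1 - s)\<^sup>2 * (1 + s))
    = D * P + ((1 + s)\<^sup>2 - D) * (k * s * (1 - s)\<^sup>2)"
    unfolding P_def by algebra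
  also have "\<dots> \<ge> 0"
    using P D k s by (intro add_nonneg_nonneg mult_nonneg_nonneg) auto
  finally show ?thesis by simp
qed

text \<open>All \<epsilon> are treated at once: with u = w / (1 - w)^2 one has Re (\<epsilon> u)
  \<ge> -|u|. The resulting bound is attained at w = -|w| with \<epsilon> = 1, so nothing is lost at
  the point that serves as the reference value later.\<close>

lemma Re_conv_kernel_ge:
  fixes w \<epsilon> :: complex and \<delta> :: real
  assumes w: "norm w < 1" and \<epsilon>: "norm \<epsilon> \<le> 1" and \<delta>: "\<delta> < 1"
  defines "D \<equiv> (norm (1 - w))\<^sup>2"
  shows "Re (conv_kernel ((1 + \<epsilon>) / of_real (2 * (1 - \<delta>))) w)
     \<ge> (1 - Re w) / D - (norm w - Re w) * (1 + norm w)\<^sup>2 / (2 * (1 - \<delta>) * D\<^sup>2)"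
proof -
  define s where "s = norm w"
  define x where "x = Re w"
  define y where "y = Im w"
  define u where "u = w / (1 - w)\<^sup>2"
  have w1: "w \<noteq> 1" using w by auto
  have D0: "D > 0" using w1 by (simp add: D_def)
  have s2: "s\<^sup>2 = x\<^sup>2 + y\<^sup>2" by (simp add: s_def x_def y_def cmod_power2)
  have D: "D = (1 - x)\<^sup>2 + y\<^sup>2" by (simp add: D_def cmod_power2 x_def y_def)
  have nu: "norm u = s / D" by (simp add: u_def norm_divide norm_power D_def s_def)
  have Re1: "Re (1 / (1 - w)) = (1 - x) / D"
    by (simp add: Re_divide D x_def y_def)
  have Reu: "Re u = (x * (1 + s\<^sup>2) - 2 * s\<^sup>2) / D\<^sup>2"
  proof -
    have Dc: "of_real D = (1 - w) * cnj (1 - w)"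
      by (simp only: D_def complex_norm_square)
    have "u = w * (cnj (1 - w))\<^sup>2 / of_real (D\<^sup>2)"
      unfolding u_def using w1 
      by (simp add: Dc power_mult_distrib divide_simps)
    moreover have "Re (w * (cnj (1 - w))\<^sup>2) = x * (1 + s\<^sup>2) - 2 * s\<^sup>2"
      unfolding s2 by (simp add: x_def y_def power2_eq_square algebra_simps)
    ultimately show ?thesis by (metis Re_divide_of_real)
  qed
  have "Re (\<epsilon> * u) \<ge> - (s / D)"
  proof -
    have "norm (\<epsilon> * u) \<le> s / D"
      using mult_right_mono[OF \<epsilon> norm_ge_zero, of u] by (simp add: norm_mult nu)
    then show ?thesis using abs_Re_le_cmod[of "\<epsilon> * u"] by linarith
  qed
  then have "Re u + Re (\<epsilon> * u) \<ge> (x * (1 + s\<^sup>2) - 2 * s\<^sup>2 - s * D) / D\<^sup>2"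
    using D0 unfolding Reu by (simp add: diff_divide_distrib power2_eq_square)
  also have "x * (1 + s\<^sup>2) - 2 * s\<^sup>2 - s * D = - (s - x) * (1 + s)\<^sup>2"
    using s2 D by algebra
  finally have "(Re u + Re (\<epsilon> * u)) / (2 * (1 - \<delta>)) \<ge> (- (s - x) * (1 + s)\<^sup>2 / D\<^sup>2) / (2 * (1 - \<delta>))"
    using \<delta> by (intro divide_right_mono) auto
  moreover have "conv_kernel ((1 + \<epsilon>) / of_real (2 * (1 - \<delta>))) w
      = 1 / (1 - w) + (u + \<epsilon> * u) / of_real (2 * (1 - \<delta>))"
    unfolding conv_kernel_def u_def by (simp only: divide_inverse algebra_simps mult_1_left)
  then have "Re (conv_kernel ((1 + \<epsilon>) / of_real (2 * (1 - \<delta>))) w)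
      = (1 - x) / D + (Re u + Re (\<epsilon> * u)) / (2 * (1 - \<delta>))"
    by (simp only: Re1 plus_complex.sel Re_divide_of_real)
  moreover have "(- (s - x) * (1 + s)\<^sup>2 / D\<^sup>2) / (2 * (1 - \<delta>)) = - ((s - x) * (1 + s)\<^sup>2 / (2 * (1 - \<delta>) * D\<^sup>2))"
    by (simp only: mult_minus_left minus_divide_left divide_divide_eq_left mult.commute)
  ultimately show ?thesis
    unfolding s_def[symmetric] x_def[symmetric] by linarith
qed

text \<open>
  The factor \<open>s\<^sup>2 (1 - s) powr (2 + 2\<delta>)\<close> is what matches the \<open>|1 - w|\<^sup>-\<^sup>4\<close> part of the kernel difference; the factor
  \<open>1 - \<delta>s/(1 + \<delta>)\<close> makes the remaining cubic divisible by \<open>1 - s\<close>, with a non-negative quotient up to \<open>\<delta> = 1/2\<close>.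
\<close>

definition comparison_fun :: "real \<Rightarrow> real \<Rightarrow> real \<Rightarrow> real" where
  "comparison_fun \<delta> y s = s\<^sup>2 * (1 - s) powr (2 + 2 * \<delta>) * (1 - \<delta> / (1 + \<delta>) * s) / (1 - 2 * y * s + s\<^sup>2)"

definition comparison_deriv :: "real \<Rightarrow> real \<Rightarrow> real \<Rightarrow> real" where
  "comparison_deriv \<delta> y s = (let D = 1 - 2 * y * s + s\<^sup>2; k = \<delta> / (1 + \<delta>) in
     s * (1 - s) powr (1 + 2 * \<delta>) * (D * (1 - (3 + 2 * \<delta>) * s) * (1 - k * s) - D * s * (1 - s) * k
       + (1 - k * s) * (1 - s)\<^sup>2 * (1 + s)) / D\<^sup>2)"

lemma comparison_denom_pos:
  fixes s y :: real
  assumes "0 \<le> s" "s < 1" "\<bar>y\<bar> \<le> 1"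
  shows "1 - 2 * y * s + s\<^sup>2 > 0"
proof -
  have "1 - 2 * y * s + s\<^sup>2 \<ge> (1 - s)\<^sup>2"
    using assms mult_right_mono[of y 1 s] by (simp add: power2_eq_square algebra_simps)
  then show ?thesis using assms by (smt (verit) zero_less_power)
qed

lemma comparison_fun_has_deriv:
  assumes s: "0 \<le> s" "s < 1" and y: "\<bar>y\<bar> \<le> 1"
  shows "(comparison_fun \<delta> y has_real_derivative comparison_deriv \<delta> y s) (at s)"
proof -
  define D where "D = 1 - 2 * y * s + s\<^sup>2"
  define k where "k = \<delta> / (1 + \<delta>)"
  define Q where "Q = (1 - s) powr (1 + 2 * \<delta>)"
  have D0: "D > 0" unfolding D_def by (rule comparison_denom_pos) fact+
  \<comment> \<open>With the larger power reduced to \<open>Q\<close>, every term of the quotient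
    rule carries the factor \<open>Q\<close>, and the rest is a polynomial identity.\<close>
  have pw: "(1 - s) powr (2 + 2 * \<delta>) = Q * (1 - s)"
    using s powr_mult_base[of "1 - s" "1 + 2 * \<delta>"] by (simp add: Q_def add_ac mult_ac)
  have dQ: "((\<lambda>s. (1 - s) powr (2 + 2 * \<delta>)) has_real_derivative (- (2 + 2 * \<delta>) * Q)) (at s)"
    by (rule derivative_eq_intros refl | (use s in simp; fail))+ (use s in \<open>simp add: Q_def algebra_simps\<close>)
  have dN: "((\<lambda>s. s\<^sup>2 * (1 - s) powr (2 + 2 * \<delta>) * (1 - k * s)) has_real_derivative
      ((2 * s * (Q * (1 - s)) + s\<^sup>2 * (- (2 + 2 * \<delta>) * Q)) * (1 - k * s) + s\<^sup>2 * (Q * (1 - s)) * (- k))) (at s)"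
    by (rule dQ derivative_eq_intros refl)+ (unfold pw, simp add: algebra_simps)
  have dD: "((\<lambda>s. 1 - 2 * y * s + s\<^sup>2) has_real_derivative (2 * s - 2 * y)) (at s)"
    by (rule derivative_eq_intros refl)+ simp
  have "((\<lambda>s. s\<^sup>2 * (1 - s) powr (2 + 2 * \<delta>) * (1 - k * s) / (1 - 2 * y * s + s\<^sup>2)) has_real_derivative
      (((2 * s * (Q * (1 - s)) + s\<^sup>2 * (- (2 + 2 * \<delta>) * Q)) * (1 - k * s) + s\<^sup>2 * (Q * (1 - s)) * (- k)) * D
        - s\<^sup>2 * (Q * (1 - s)) * (1 - k * s) * (2 * s - 2 * y)) / (D * D)) (at s)"
    using DERIV_divide[OF dN dD] D0 unfolding D_def[symmetric] pw by simp
  also have "((2 * s * (Q * (1 - s)) + s\<^sup>2 * (- (2 + 2 * \<delta>) * Q)) * (1 - k * s) + s\<^sup>2 * (Q * (1 - s)) * (- k)) * D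
        - s\<^sup>2 * (Q * (1 - s)) * (1 - k * s) * (2 * s - 2 * y)
     = s * Q * (D * (1 - (3 + 2 * \<delta>) * s) * (1 - k * s) - D * s * (1 - s) * k
       + (1 - k * s) * (1 - s)\<^sup>2 * (1 + s))"
    unfolding D_def by algebra
  finally show ?thesis
    unfolding comparison_fun_def[abs_def] comparison_deriv_def Let_def k_def D_def Q_def power2_eq_square[of "_ + _"] .
qed

lemma comparison_fun_nonneg:
  assumes "0 \<le> s" "s < 1" "\<bar>y\<bar> \<le> 1" "0 \<le> \<delta>"
  shows "comparison_fun \<delta> y s \<ge> 0"
proof -
  have "\<delta> / (1 + \<delta>) * s \<le> 1 * 1" using assms by (intro mult_mono) auto
  then show ?thesis
    using comparison_denom_pos[of s y] assms
    by (auto simp: comparison_fun_def intro!: divide_nonneg_nonneg mult_nonneg_nonneg)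
qed

lemma continuous_on_comparison_deriv:
  assumes y: "\<bar>y\<bar> \<le> 1"
  shows "continuous_on {0..<1} (comparison_deriv \<delta> y)"
proof -
  have D: "(1 - 2 * y * s + s\<^sup>2)\<^sup>2 \<noteq> 0" if "s \<in> {0..<1}" for s
    using comparison_denom_pos[of s y] y that by simp
  have P: "continuous_on {0..<1} (\<lambda>s. (1 - s) powr (1 + 2 * \<delta>))"
    by (rule continuous_on_powr) (auto intro!: continuous_on_diff)
  show ?thesis
    unfolding comparison_deriv_def Let_def
  proof (intro continuous_on_divide ballI)
    show "continuous_on {0..<1} (\<lambda>x. (1 - 2 * y * x + x\<^sup>2)\<^sup>2)"
      by (intro continuous_intros)
    show "(1 - 2 * y * s + s\<^sup>2)\<^sup>2 \<noteq> 0" if "s \<in> {0..<1}" for s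
      using D[OF that] .
    show "continuous_on {0..<1} (\<lambda>s. s * (1 - s) powr (1 + 2 * \<delta>) *
        ((1 - 2 * y * s + s\<^sup>2) * (1 - (3 + 2 * \<delta>) * s) * (1 - \<delta> / (1 + \<delta>) * s)
        - (1 - 2 * y * s + s\<^sup>2) * s * (1 - s) * (\<delta> / (1 + \<delta>)) + (1 - \<delta> / (1 + \<delta>) * s) * (1 - s)\<^sup>2 * (1 + s)))"
      by (intro continuous_on_mult P continuous_on_add continuous_on_diff continuous_on_power continuous_on_id continuous_on_const)
  qed
qed

text \<open>The lower bound for the kernel minus its value at -s vanishes in the extremal direction
  u = -1, so it carries the factor p = 1 + Re u; the left side is given the same factor. Removing
  the common non-negative factors leaves \<open>kernel_polynomial_ineq\<close>. The constant in
  front of \<open>comparison_deriv\<close> is independent of s and can be taken out of an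
  integral.\<close>

lemma conv_kernel_compare:
  fixes s \<delta> :: real
  assumes s: "0 \<le> s" "s < 1" and u: "norm u = 1" and \<epsilon>: "norm \<epsilon> \<le> 1" and \<delta>: "0 \<le> \<delta>" "\<delta> \<le> 1/2"
  shows "(1 + Re u) / (2 * (1 - \<delta>)) * comparison_deriv \<delta> (Re u) s
    \<le> (1 + s) * (1 - s) powr (1 + 2 * \<delta>) *
      (Re (conv_kernel ((1 + \<epsilon>) / of_real (2 * (1 - \<delta>))) (of_real s * u)) - conv_kernel (1 / (1 - \<delta>)) (- s))"
proof -
  define y where "y = Re u"
  define p where "p = 1 + y"
  define D where "D = 1 - 2 * y * s + s\<^sup>2"
  define k where "k = \<delta> / (1 + \<delta>)"
  define Q where "Q = (1 - s) powr (1 + 2 * \<delta>)"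
  define w where "w = of_real s * u"
  define N where "N = D * (2 * (1 - \<delta>) * (1 - s\<^sup>2) - 4 * s) + (1 + s)\<^sup>2 * (1 - s)\<^sup>2"
  define M where "M = D * (1 - (3 + 2 * \<delta>) * s) * (1 - k * s) - D * s * (1 - s) * k
       + (1 - k * s) * (1 - s)\<^sup>2 * (1 + s)"
  have y: "\<bar>y\<bar> \<le> 1" using abs_Re_le_cmod[of u] u by (simp add: y_def)
  have D0: "D > 0" unfolding D_def by (rule comparison_denom_pos) fact+
  have Dp: "D = (1 + s)\<^sup>2 - 2 * s * p" by (simp add: D_def p_def power2_eq_square algebra_simps)
  have uu: "(Re u)\<^sup>2 + (Im u)\<^sup>2 = 1" using u cmod_power2[of u] by simp
  have nD: "(norm (1 - w))\<^sup>2 = D"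
    unfolding cmod_power2 using uu by (simp add: w_def D_def y_def) algebra
  have nw: "norm w = s" "Re w = s * y" using s u by (simp_all add: w_def norm_mult y_def)
  have "(1 - s * y) / D - s * (1 - y) * (1 + s)\<^sup>2 / (2 * (1 - \<delta>) * D\<^sup>2)
      \<le> Re (conv_kernel ((1 + \<epsilon>) / of_real (2 * (1 - \<delta>))) w)"
    using Re_conv_kernel_ge[of w \<epsilon> \<delta>] s \<epsilon> \<delta> unfolding nD nw by (simp add: algebra_simps)
  then have A: "(1 - s * y) / D - s * (1 - y) * (1 + s)\<^sup>2 / (2 * (1 - \<delta>) * D\<^sup>2) - conv_kernel (1 / (1 - \<delta>)) (- s)
     \<le> Re (conv_kernel ((1 + \<epsilon>) / of_real (2 * (1 - \<delta>))) w) - conv_kernel (1 / (1 - \<delta>)) (- s)"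
    by simp
  have eq: "(1 - s * y) / D - s * (1 - y) * (1 + s)\<^sup>2 / (2 * (1 - \<delta>) * D\<^sup>2) - conv_kernel (1 / (1 - \<delta>)) (- s)
     = s * p * N / (2 * (1 - \<delta>) * D\<^sup>2 * (1 + s)\<^sup>2)"
  proof -
    have [simp]: "1 + s \<noteq> 0" "1 - \<delta> \<noteq> 0" "\<delta> \<noteq> 1" "D \<noteq> 0" using s \<delta> D0 by auto
    have e1: "(1 - s * y) / D = 2 * (1 - \<delta>) * D * (1 + s)\<^sup>2 * (1 - s * y) / (2 * (1 - \<delta>) * D\<^sup>2 * (1 + s)\<^sup>2)"
      by (simp add: power2_eq_square)
    have e2: "s * (1 - y) * (1 + s)\<^sup>2 / (2 * (1 - \<delta>) * D\<^sup>2) = s * (1 - y) * (1 + s)^4 / (2 * (1 - \<delta>) * D\<^sup>2 * (1 + s)\<^sup>2)"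
      by (simp add: divide_simps)
    have e3: "conv_kernel (1 / (1 - \<delta>)) (- s) = (2 * (1 - \<delta>) * (1 + s) - 2 * s) * D\<^sup>2 / (2 * (1 - \<delta>) * D\<^sup>2 * (1 + s)\<^sup>2)"
      by (simp add: conv_kernel_def divide_simps power2_eq_square) (simp add: algebra_simps)
    \<comment> \<open>The factor s p is expected: the difference is zero for s = 0 and for y =
      -1.\<close>
    have e4: "2 * (1 - \<delta>) * D * (1 + s)\<^sup>2 * (1 - s * y) - s * (1 - y) * (1 + s)^4
       - (2 * (1 - \<delta>) * (1 + s) - 2 * s) * D\<^sup>2 = s * p * N"
      unfolding N_def D_def p_def by algebra
    show ?thesis unfolding e1 e2 e3 diff_divide_distrib[symmetric] e4 ..
  qed
  have k: "k * (1 + \<delta>) = \<delta>" "k \<ge> 0" using \<delta> by (auto simp: k_def)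
  have p: "p \<ge> 0" using y by (simp add: p_def)
  then have "D \<le> (1 + s)\<^sup>2" using s unfolding Dp by simp
  then have "(1 + s) * M \<le> N"
    unfolding M_def N_def using kernel_polynomial_ineq[of s \<delta> D k] s \<delta> k D0 by simp
  then have "p / (2 * (1 - \<delta>)) * (s * Q / (D\<^sup>2 * (1 + s))) * ((1 + s) * M) \<le> p / (2 * (1 - \<delta>)) * (s * Q / (D\<^sup>2 * (1 + s))) * N"
    using p s \<delta> by (intro mult_left_mono) (auto simp: Q_def)
  also have "\<dots> = (1 + s) * Q * (s * p * N / (2 * (1 - \<delta>) * D\<^sup>2 * (1 + s)\<^sup>2))"
    using s by (simp add: power2_eq_square mult_ac)
  also have "\<dots> \<le> (1 + s) * Q * (Re (conv_kernel ((1 + \<epsilon>) / of_real (2 * (1 - \<delta>))) w) - conv_kernel (1 / (1 - \<delta>)) (- s))"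
    using A s unfolding eq by (intro mult_left_mono) (auto simp: Q_def)
  also have "p / (2 * (1 - \<delta>)) * (s * Q / (D\<^sup>2 * (1 + s))) * ((1 + s) * M) = p / (2 * (1 - \<delta>)) * comparison_deriv \<delta> y s"
    using s by (simp add: comparison_deriv_def Let_def D_def[symmetric] k_def[symmetric] Q_def[symmetric] M_def)
  finally show ?thesis by (simp add: p_def y_def w_def Q_def)
qed

text \<open>Formally, integration by parts gives \<psi>(1) S(1) plus the integral of S against
  -d\<psi>, both non-negative. As \<psi> may blow up at 0 and has arbitrary values at both
  endpoints, the second mean value theorem replaces this computation.\<close>

lemma integral_decreasing_times_deriv_nonneg:
  fixes \<psi> S S' :: "real \<Rightarrow> real"
  assumes \<psi>: "\<psi> integrable_on {0..1}" and nonneg: "\<And>t. 0 < t \<Longrightarrow> t < 1 \<Longrightarrow> \<psi> t \<ge> 0"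
    and mono: "\<And>s t. 0 < s \<Longrightarrow> s \<le> t \<Longrightarrow> t < 1 \<Longrightarrow> \<psi> t \<le> \<psi> s"
    and S: "\<And>t. 0 \<le> t \<Longrightarrow> t \<le> 1 \<Longrightarrow> (S has_real_derivative S' t) (at t)"
    and S'c: "continuous_on {0..1} S'"
    and S0: "S 0 = 0" and Sn: "\<And>t. 0 \<le> t \<Longrightarrow> t \<le> 1 \<Longrightarrow> S t \<ge> 0"
  shows "(\<lambda>t. \<psi> t * S' t) integrable_on {0..1}" "integral {0..1} (\<lambda>t. \<psi> t * S' t) \<ge> 0"
proof -
  \<comment> \<open>Truncating \<open>\<psi>\<close> at \<open>n\<close> makes the second mean value theorem applicable up to the endpoint \<open>0\<close>.\<close>
  define \<psi>0 where "\<psi>0 = (\<lambda>t. if 0 < t \<and> t < 1 then \<psi> t else 0)"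
  define \<psi>n where "\<psi>n = (\<lambda>n t. if t \<le> 0 then real n else if t < 1 then min (\<psi> t) (real n) else 0)"
  have fin: "finite {0, 1::real}" by simp
  have \<psi>0: "\<psi>0 integrable_on {0..1}"
    by (rule integrable_spike_finite[OF fin _ \<psi>]) (auto simp: \<psi>0_def)
  have S'int: "S' integrable_on {a..b}" if "0 \<le> a" "b \<le> 1" for a b
    using S'c that by (intro integrable_continuous_real) (auto intro: continuous_on_subset)
  have S'has: "integral {a..b} S' = S b - S a" if "0 \<le> a" "a \<le> b" "b \<le> 1" for a b
    using that S by (intro integral_unique fundamental_theorem_of_calculus)
      (auto simp: has_real_derivative_iff_has_vector_derivative intro: has_vector_derivative_at_within)
  obtain B where "\<forall>x\<in>S' ` {0..1}. norm x \<le> B"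
    using compact_imp_bounded[OF compact_continuous_image[OF S'c compact_Icc]] unfolding bounded_iff by blast
  then have B: "\<bar>S' t\<bar> \<le> B" if "t \<in> {0..1}" for t
    using that by auto
  have step: "(\<lambda>t. \<psi>n n t * S' t) integrable_on {0..1}" "integral {0..1} (\<lambda>t. \<psi>n n t * S' t) \<ge> 0" for n
  proof -
    have mon: "- \<psi>n n x \<le> - \<psi>n n y" if "0 \<le> x" "x \<le> y" "y \<le> 1" for x y
      using mono[of x y] nonneg that by (auto simp: \<psi>n_def min_def) 
    \<comment> \<open>With the endpoint values n at 0 and 0 at 1, the mean value formula collapses
      to n (S c - S 0) = n S c, up to the sign that makes the function increasing.\<close>
    obtain c where c: "c \<in> {0..1}" and
      "((\<lambda>t. - \<psi>n n t * S' t) has_integral (- \<psi>n n 0 * integral {0..c} S' + - \<psi>n n 1 * integral {c..1} S')) {0..1}"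
      by (rule second_mean_value_theorem_full[of S' 0 1 "\<lambda>t. - \<psi>n n t"]) (use S'int mon in auto)
    then have "((\<lambda>t. - (\<psi>n n t * S' t)) has_integral - (real n * S c)) {0..1}"
      using S'has[of 0 c] S0 by (simp add: \<psi>n_def)
    then have "((\<lambda>t. \<psi>n n t * S' t) has_integral real n * S c) {0..1}"
      by (simp add: has_integral_neg_iff)
    moreover have "real n * S c \<ge> 0" using Sn c by simp
    ultimately show "(\<lambda>t. \<psi>n n t * S' t) integrable_on {0..1}" "integral {0..1} (\<lambda>t. \<psi>n n t * S' t) \<ge> 0"
      by (auto simp: integrable_on_def integral_unique)
  qed
  \<comment> \<open>The artificial value n at 0 admits no bound uniform in n, so it is reset before
    dominated convergence; the integrals do not change.\<close>
  define F where "F = (\<lambda>n t. if t = 0 then 0 else \<psi>n n t * S' t)"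
  have F: "F n integrable_on {0..1}" for n
    by (rule integrable_spike_finite[of "{0}", OF _ _ step(1)[of n]]) (auto simp: F_def)
  have Fi: "integral {0..1} (F n) = integral {0..1} (\<lambda>t. \<psi>n n t * S' t)" for n
    by (rule integral_spike[of "{0}"]) (auto simp: F_def)
  have h: "(\<lambda>t. \<psi>0 t * B) integrable_on {0..1}" using \<psi>0 by (rule integrable_on_mult_left)
  have le: "norm (F n t) \<le> \<psi>0 t * B" if "t \<in> {0..1}" for n t
  proof (cases "0 < t \<and> t < 1")
    case True
    have "\<bar>min (\<psi> t) (real n) * S' t\<bar> \<le> \<psi> t * B"
      unfolding abs_mult using True B[OF that] nonneg[of t] by (intro mult_mono) (auto simp: abs_if min_def)
    then show ?thesis using True by (simp add: F_def \<psi>n_def \<psi>0_def)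
  qed (use that in \<open>auto simp: F_def \<psi>n_def \<psi>0_def\<close>)
  have lim: "(\<lambda>n. F n t) \<longlonglongrightarrow> \<psi>0 t * S' t" if "t \<in> {0..1}" for t
  proof -
    obtain N where "\<psi> t \<le> real N" using real_arch_simple by blast
    then have "eventually (\<lambda>n. F n t = \<psi>0 t * S' t) sequentially"
      using that by (intro eventually_sequentiallyI[of N]) (auto simp: F_def \<psi>0_def \<psi>n_def)
    then show ?thesis by (rule tendsto_eventually)
  qed
  note dc = dominated_convergence[OF F h le lim]
  show "(\<lambda>t. \<psi> t * S' t) integrable_on {0..1}"
    by (rule integrable_spike_finite[OF fin _ dc(1)]) (auto simp: \<psi>0_def)
  have "integral {0..1} (\<lambda>t. \<psi>0 t * S' t) \<ge> 0"
    by (rule LIMSEQ_le_const[OF dc(2)]) (use step(2) Fi in auto)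
  also have "integral {0..1} (\<lambda>t. \<psi>0 t * S' t) = integral {0..1} (\<lambda>t. \<psi> t * S' t)"
    by (rule integral_spike[of "{0,1}"]) (auto simp: \<psi>0_def)
  finally show "integral {0..1} (\<lambda>t. \<psi> t * S' t) \<ge> 0" .
qed

subsection \<open>Integrals of the kernel against a decreasing weight\<close>

lemma absolutely_integrable_scaleR_continuous:
  fixes \<omega> :: "real \<Rightarrow> real" and g :: "real \<Rightarrow> 'a::euclidean_space"
  assumes "\<omega> absolutely_integrable_on {a..b}" "continuous_on {a..b} g"
  shows "(\<lambda>t. \<omega> t *\<^sub>R g t) absolutely_integrable_on {a..b}"
proof -
  have "(\<lambda>t. (\<lambda>v c. c *\<^sub>R v) (g t) (\<omega> t)) absolutely_integrable_on {a..b}"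
  proof (rule absolutely_integrable_bounded_measurable_product[where h = "\<lambda>v c. c *\<^sub>R v"])
    show "bilinear (\<lambda>(v::'a) (c::real). c *\<^sub>R v)"
      by (simp add: bilinear_def linear_iff scaleR_add_left scaleR_add_right)
    show "g \<in> borel_measurable (lebesgue_on {a..b})"
      by (rule continuous_imp_measurable_on_sets_lebesgue) (use assms in auto)
    show "bounded (g ` {a..b})"
      using assms compact_continuous_image compact_imp_bounded compact_Icc by blast
  qed (use assms in auto)
  then show ?thesis by simp
qed

lemma absolutely_integrable_mult_continuous:
  fixes \<omega> g :: "real \<Rightarrow> real"
  assumes "\<omega> absolutely_integrable_on {a..b}" "continuous_on {a..b} g"
  shows "(\<lambda>t. \<omega> t * g t) absolutely_integrable_on {a..b}"
  using absolutely_integrable_scaleR_continuous[OF assms] by simp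

text \<open>Dominated convergence with the bound |\<omega>| times the sum of the norms of the
  \<open>b m\<close>, which holds up to t = 1. This is how an integral transform becomes
  multiplication of coefficients by moments.\<close>

lemma integral_power_series:
  fixes \<omega> :: "real \<Rightarrow> real" and b :: "nat \<Rightarrow> 'a::euclidean_space"
  assumes \<omega>: "\<omega> absolutely_integrable_on {0..1}" and b: "summable (\<lambda>m. norm (b m))"
  shows "(\<lambda>t. \<omega> t *\<^sub>R (\<Sum>m. t^m *\<^sub>R b m)) integrable_on {0..1}"
    and "(\<lambda>m. integral {0..1} (\<lambda>t. \<omega> t * t^m) *\<^sub>R b m) sums integral {0..1} (\<lambda>t. \<omega> t *\<^sub>R (\<Sum>m. t^m *\<^sub>R b m))"
proof -
  have nb: "norm (t^m *\<^sub>R b m) \<le> norm (b m)" if "t \<in> {0..1}" for t :: real and m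
    using that mult_right_mono[of "t^m" 1 "norm (b m)"] by (simp add: power_le_one)
  have sb: "summable (\<lambda>m. norm (t^m *\<^sub>R b m))" if "t \<in> {0..1}" for t :: real
    by (rule summable_comparison_test'[OF b, of 0]) (use nb[OF that] in auto)
  have I: "(\<lambda>t. \<omega> t * t^m) integrable_on {0..1}" for m
    by (rule set_lebesgue_integral_eq_integral(1)[OF absolutely_integrable_mult_continuous[OF \<omega>]])
      (rule continuous_on_power[OF continuous_on_id])
  have eq: "\<omega> t *\<^sub>R (\<Sum>m<n. t^m *\<^sub>R b m) = (\<Sum>m<n. (\<omega> t * t^m) *\<^sub>R b m)" for t n
    by (simp add: scaleR_sum_right)
  have Ib: "((\<lambda>t. (\<omega> t * t^m) *\<^sub>R b m) has_integral integral {0..1} (\<lambda>t. \<omega> t * t^m) *\<^sub>R b m) {0..1}" for m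
    by (intro has_integral_scaleR_left integrable_integral I)
  have S: "((\<lambda>t. \<omega> t *\<^sub>R (\<Sum>m<n. t^m *\<^sub>R b m)) has_integral (\<Sum>m<n. integral {0..1} (\<lambda>t. \<omega> t * t^m) *\<^sub>R b m)) {0..1}" for n
    unfolding eq by (intro has_integral_sum Ib) auto
  have h: "(\<lambda>t. \<bar>\<omega> t\<bar> * (\<Sum>m. norm (b m))) integrable_on {0..1}"
    using \<omega> by (intro integrable_on_mult_left) (simp add: absolutely_integrable_on_def)
  have le: "norm (\<omega> t *\<^sub>R (\<Sum>m<n. t^m *\<^sub>R b m)) \<le> \<bar>\<omega> t\<bar> * (\<Sum>m. norm (b m))" if "t \<in> {0..1}" for t n
  proof -
    have "norm (\<Sum>m<n. t^m *\<^sub>R b m) \<le> (\<Sum>m<n. norm (b m))"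
      by (intro sum_norm_le nb that)
    also have "\<dots> \<le> (\<Sum>m. norm (b m))" by (rule sum_le_suminf[OF b]) auto
    finally show ?thesis by (simp add: mult_left_mono)
  qed
  have lim: "(\<lambda>n. \<omega> t *\<^sub>R (\<Sum>m<n. t^m *\<^sub>R b m)) \<longlonglongrightarrow> \<omega> t *\<^sub>R (\<Sum>m. t^m *\<^sub>R b m)" if "t \<in> {0..1}" for t
    by (intro tendsto_scaleR tendsto_const summable_LIMSEQ summable_norm_cancel[OF sb[OF that]])
  note dc = dominated_convergence[OF has_integral_integrable[OF S] h le lim]
  show "(\<lambda>t. \<omega> t *\<^sub>R (\<Sum>m. t^m *\<^sub>R b m)) integrable_on {0..1}" by (rule dc(1))
  show "(\<lambda>m. integral {0..1} (\<lambda>t. \<omega> t * t^m) *\<^sub>R b m) sums integral {0..1} (\<lambda>t. \<omega> t *\<^sub>R (\<Sum>m. t^m *\<^sub>R b m))"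
    using dc(2) unfolding sums_def integral_unique[OF S] .
qed

lemma conv_kernel_minus_real:
  fixes s :: real
  assumes "s \<ge> 0" "\<delta> < 1"
  shows "conv_kernel (1 / (1 - \<delta>)) (- s) = (1 - \<delta> - \<delta> * s) / ((1 - \<delta>) * (1 + s)\<^sup>2)"
proof -
  have "1 + s \<noteq> 0" "1 - \<delta> \<noteq> 0" using assms by auto
  then show ?thesis
    by (simp add: conv_kernel_def divide_simps power2_eq_square) (simp add: algebra_simps)
qed

text \<open>In the quotient form of \<open>conv_kernel_minus_real\<close> the numerator does not
  increase, and \<delta> \<le> 1/2 keeps it positive at s < 1. The strictness comes from the
  denominator, since the numerator is constant for \<delta> = 0.\<close>

lemma conv_kernel_strict_decreasing:
  fixes s t :: real
  assumes st: "0 \<le> s" "s < t" "t \<le> 1" and \<delta>: "0 \<le> \<delta>" "\<delta> \<le> 1/2"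
  shows "conv_kernel (1 / (1 - \<delta>)) (- t) < conv_kernel (1 / (1 - \<delta>)) (- s)"
proof -
  have "\<delta> * t \<le> \<delta>" "\<delta> * s \<le> \<delta> * t" "\<delta> * s < 1/2"
    using st \<delta> mult_left_mono[of t 1 \<delta>] mult_left_mono[of s t \<delta>] mult_mono[of \<delta> "1/2" s t] 
      mult_right_mono[of \<delta> "1/2" s] by auto
  moreover have "(1 - \<delta>) * (1 + s)\<^sup>2 < (1 - \<delta>) * (1 + t)\<^sup>2"
    using st \<delta> by (intro mult_strict_left_mono power_strict_mono) auto
  ultimately have "(1 - \<delta> - \<delta> * t) / ((1 - \<delta>) * (1 + t)\<^sup>2) < (1 - \<delta> - \<delta> * s) / ((1 - \<delta>) * (1 + s)\<^sup>2)"
    using st \<delta>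
    by (intro order_le_less_trans[OF divide_right_mono divide_strict_left_mono[where c = "1 - \<delta> - \<delta> * s"]]) auto
  then show ?thesis using st \<delta> by (simp only: conv_kernel_minus_real)
qed

text \<open>Passing from \<open>t\<close> to \<open>\<rho>t\<close> in the weight keeps it decreasing, so no boundary values on \<open>|z| = 1\<close> are needed.\<close>

lemma conv_weight_ratio_decreasing:
  fixes s t \<rho> \<delta> :: real
  assumes st: "0 < s" "s \<le> t" "t < 1" and \<rho>: "0 \<le> \<rho>" "\<rho> < 1" and \<delta>: "0 \<le> \<delta>"
  shows "((1 + t) * (1 - t) powr (1 + 2 * \<delta>)) / ((1 + \<rho> * t) * (1 - \<rho> * t) powr (1 + 2 * \<delta>))
    \<le> ((1 + s) * (1 - s) powr (1 + 2 * \<delta>)) / ((1 + \<rho> * s) * (1 - \<rho> * s) powr (1 + 2 * \<delta>))"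
proof -
  have lt: "\<rho> * x < 1" if "0 < x" "x < 1" for x
    using that \<rho> mult_le_one[of \<rho> x] mult_strict_mono[of \<rho> 1 x 1] by simp
  \<comment> \<open>One factor 1 - x is paired with 1 + x; this leaves two non-negative factors,
    each of which decreases in x.\<close>
  have rew: "((1 + x) * (1 - x) powr (1 + 2 * \<delta>)) / ((1 + \<rho> * x) * (1 - \<rho> * x) powr (1 + 2 * \<delta>))
     = (1 - x\<^sup>2) / (1 - (\<rho> * x)\<^sup>2) * ((1 - x) / (1 - \<rho> * x)) powr (2 * \<delta>)" if "0 < x" "x < 1" for x
  proof -
    have "(1 - x) powr (1 + 2 * \<delta>) = (1 - x) * (1 - x) powr (2 * \<delta>)"
      "(1 - \<rho> * x) powr (1 + 2 * \<delta>) = (1 - \<rho> * x) * (1 - \<rho> * x) powr (2 * \<delta>)"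
      using that lt[OF that] by (simp_all add: powr_add)
    moreover have "1 - x\<^sup>2 = (1 + x) * (1 - x)" "1 - (\<rho> * x)\<^sup>2 = (1 + \<rho> * x) * (1 - \<rho> * x)"
      by (simp_all add: power2_eq_square algebra_simps)
    ultimately show ?thesis
      using that lt[OF that] by (simp add: powr_divide)
  qed
  have a: "(\<rho> * t)\<^sup>2 < 1" "(\<rho> * s)\<^sup>2 < 1" using lt[of t] lt[of s] st \<rho> by (auto intro!: power_less_one_iff[THEN iffD2] simp: power_less_one_iff)
  have t2: "t\<^sup>2 < 1" "s\<^sup>2 < 1" using st by (auto simp: power_less_one_iff)
  have "(s\<^sup>2 - t\<^sup>2) * (1 - \<rho>\<^sup>2) \<le> 0"
    using st \<rho> by (intro mult_nonpos_nonneg) (auto simp: power_mono power_le_one)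
  then have "(1 - t\<^sup>2) / (1 - (\<rho> * t)\<^sup>2) \<le> (1 - s\<^sup>2) / (1 - (\<rho> * s)\<^sup>2)"
    using a by (simp add: frac_le_eq divide_nonpos_pos field_simps power_mult_distrib) 
  moreover have "(1 - t) / (1 - \<rho> * t) \<le> (1 - s) / (1 - \<rho> * s)"
  proof -
    have "(s - t) * (1 - \<rho>) \<le> 0" using st \<rho> by (intro mult_nonpos_nonneg) auto
    then show ?thesis using lt[of t] lt[of s] st by (simp add: field_simps)
  qed
  ultimately show ?thesis
    using st lt[of t] lt[of s] a t2 \<delta> by (simp only: rew order_less_le_trans order_le_less_trans)
      (intro mult_mono powr_mono2, auto)
qed

text \<open>Along the ray through z the pointwise comparison is applied at s = \<rho> t with \<rho>
  = |z|. Dividing \<omega> by the factor \<open>G\<close> taken at \<rho> t turns the integrand into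
  a decreasing weight times at least a non-negative multiple of \<open>S'\<close>. The case z = 0 is
  separate because there is no direction \<open>u\<close>.\<close>

lemma weighted_kernel_integral_ge:
  fixes \<omega> :: "real \<Rightarrow> real" and z \<epsilon> :: complex
  assumes \<omega>: "\<omega> absolutely_integrable_on {0..1}" and nonneg: "\<And>t. t \<in> {0..1} \<Longrightarrow> \<omega> t \<ge> 0"
    and mono: "\<And>s t. 0 < s \<Longrightarrow> s \<le> t \<Longrightarrow> t < 1 \<Longrightarrow>
      \<omega> t / ((1 + t) * (1 - t) powr (1 + 2 * \<delta>)) \<le> \<omega> s / ((1 + s) * (1 - s) powr (1 + 2 * \<delta>))"
    and \<delta>: "0 \<le> \<delta>" "\<delta> \<le> 1/2" and z: "norm z < 1" and \<epsilon>: "norm \<epsilon> \<le> 1"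
  shows "integral {0..1} (\<lambda>t. \<omega> t * conv_kernel (1 / (1 - \<delta>)) (- (norm z * t)))
    \<le> Re (integral {0..1} (\<lambda>t. \<omega> t *\<^sub>R conv_kernel ((1 + \<epsilon>) / of_real (2 * (1 - \<delta>))) (of_real t * z)))"
proof (cases "z = 0")
  case True
  have "integral {0..1} (\<lambda>t. \<omega> t *\<^sub>R (1::complex)) = of_real (integral {0..1} \<omega>)"
    using integral_linear[OF set_lebesgue_integral_eq_integral(1)[OF \<omega>] bounded_linear_of_real]
    by (simp add: o_def scaleR_conv_of_real)
  then show ?thesis using True by (simp add: conv_kernel_def)
next
  case False
  define \<rho> where "\<rho> = norm z"
  define u where "u = z / of_real \<rho>"
  define y where "y = Re u"
  define c where "c = (1 + \<epsilon>) / of_real (2 * (1 - \<delta>))"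
  define C where "C = (1 + y) / (2 * (1 - \<delta>))"
  define G where "G = (\<lambda>t. (1 + \<rho> * t) * (1 - \<rho> * t) powr (1 + 2 * \<delta>))"
  define \<psi> where "\<psi> = (\<lambda>t. \<omega> t * (1 / G t))"
  define X where "X = (\<lambda>t. Re (conv_kernel c (of_real t * z)) - conv_kernel (1 / (1 - \<delta>)) (- (\<rho> * t)))"
  \<comment> \<open>Division by \<rho> absorbs the chain rule factor, so the derivative is
    \<open>comparison_deriv\<close> itself.\<close>
  define S where "S = (\<lambda>t. comparison_fun \<delta> y (\<rho> * t) / \<rho>)"
  define S' where "S' = (\<lambda>t. comparison_deriv \<delta> y (\<rho> * t))"
  have \<rho>: "0 < \<rho>" "\<rho> < 1" using False z by (auto simp: \<rho>_def)
  have u: "norm u = 1" "z = of_real \<rho> * u" using \<rho> by (auto simp: u_def \<rho>_def norm_divide)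
  have y: "\<bar>y\<bar> \<le> 1" using abs_Re_le_cmod[of u] u by (simp add: y_def)
  have lt: "0 \<le> \<rho> * t" "\<rho> * t < 1" if "t \<in> {0..1}" for t
  proof -
    have "\<rho> * t \<le> \<rho> * 1" using that \<rho> by (intro mult_left_mono) auto
    then show "\<rho> * t < 1" using \<rho> by linarith
    show "0 \<le> \<rho> * t" using that \<rho> by simp
  qed
  have G0: "G t > 0" if "t \<in> {0..1}" for t
    using lt[OF that] by (auto simp: G_def intro!: mult_pos_pos)
  have contG: "continuous_on {0..1} G"
  proof -
    have "continuous_on {0..1} (\<lambda>t. (1 - \<rho> * t) powr (1 + 2 * \<delta>))"
      by (intro continuous_on_powr continuous_on_diff continuous_on_mult continuous_on_id continuous_on_const) (use lt in fastforce)
    then show ?thesis unfolding G_def by (intro continuous_on_mult continuous_on_add continuous_on_id continuous_on_const)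
  qed
  have "continuous_on {0..1} (\<lambda>t. 1 / G t)"
    using contG G0 by (intro continuous_on_divide continuous_on_const) force+
  then have \<psi>int: "\<psi> integrable_on {0..1}"
    unfolding \<psi>_def using absolutely_integrable_mult_continuous[OF \<omega>] set_lebesgue_integral_eq_integral(1) by blast
  have \<psi>0: "\<psi> t \<ge> 0" if "t \<in> {0..1}" for t
    using nonneg[OF that] G0[OF that] by (simp add: \<psi>_def)
  have \<psi>mono: "\<psi> t \<le> \<psi> s" if st: "0 < s" "s \<le> t" "t < 1" for s t
  proof -
    define W where "W = (\<lambda>t. (1 + t) * (1 - t) powr (1 + 2 * \<delta>))"
    have W: "W t > 0" "W s > 0" using st by (auto simp: W_def)
    \<comment> \<open>A product of two non-negative decreasing factors: the first by the hypothesis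
      on \<omega>, the second by \<open>conv_weight_ratio_decreasing\<close>.\<close>
    have "\<omega> t / W t * (W t / G t) \<le> \<omega> s / W s * (W s / G s)"
      using conv_weight_ratio_decreasing[OF st _ \<rho>(2), of \<delta>] \<rho> \<delta> mono[OF st] nonneg[of s] W G0[of t] st
      unfolding W_def G_def by (intro mult_mono) auto
    then show ?thesis using W by (simp add: \<psi>_def)
  qed
  have Sd: "(S has_real_derivative S' t) (at t)" if "0 \<le> t" "t \<le> 1" for t
  proof -
    have "((\<lambda>t. comparison_fun \<delta> y (\<rho> * t)) has_real_derivative comparison_deriv \<delta> y (\<rho> * t) * \<rho>) (at t)"
      using lt[of t] that y by (intro DERIV_chain2[OF comparison_fun_has_deriv]) (auto intro!: derivative_eq_intros)
    from DERIV_cdivide[OF this, of \<rho>] show ?thesis unfolding S_def S'_def using \<rho> by simp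
  qed
  have S'c: "continuous_on {0..1} S'"
    unfolding S'_def
    by (rule continuous_on_compose2[OF continuous_on_comparison_deriv[OF y]])
      (use lt in \<open>auto intro!: continuous_intros\<close>)
  have S0: "S 0 = 0" by (simp add: S_def comparison_fun_def)
  have Sn: "S t \<ge> 0" if "0 \<le> t" "t \<le> 1" for t
    using comparison_fun_nonneg[of "\<rho> * t" y \<delta>] lt[of t] that y \<delta> \<rho> by (simp add: S_def)
  note main = integral_decreasing_times_deriv_nonneg[OF \<psi>int _ \<psi>mono Sd S'c S0 Sn]
  have int: "(\<lambda>t. \<psi> t * S' t) integrable_on {0..1}" "integral {0..1} (\<lambda>t. \<psi> t * S' t) \<ge> 0"
    by (rule main; use \<psi>0 in force)+
  have C0: "C \<ge> 0" using y \<delta> by (simp add: C_def)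
  have point: "C * (\<psi> t * S' t) \<le> \<omega> t * X t" if "t \<in> {0..1}" for t
  proof -
    have "C * S' t \<le> G t * X t"
      using conv_kernel_compare[OF lt[OF that] u(1) \<epsilon> \<delta>]
      unfolding C_def S'_def G_def X_def c_def y_def u(2) by (simp add: mult_ac)
    then have "\<psi> t * (C * S' t) \<le> \<psi> t * (G t * X t)"
      by (rule mult_left_mono) (rule \<psi>0[OF that])
    then show ?thesis using G0[OF that] by (simp add: \<psi>_def mult_ac)
  qed
  have w1: "of_real t * z \<noteq> 1" if "t \<in> {0..1}" for t
  proof
    assume "of_real t * z = 1"
    then have "norm (of_real t * z) = 1" by simp
    then show False using lt[OF that] that by (simp add: norm_mult \<rho>_def mult.commute)
  qed
  have k1: "continuous_on {0..1} (\<lambda>t. conv_kernel c (of_real t * z))"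
    unfolding conv_kernel_def by (intro continuous_intros) (use w1 in auto)
  have k2: "continuous_on {0..1} (\<lambda>t. conv_kernel (1 / (1 - \<delta>)) (- (\<rho> * t)))"
    unfolding conv_kernel_def by (intro continuous_intros) (use lt in fastforce)+
  have i1: "(\<lambda>t. \<omega> t *\<^sub>R conv_kernel c (of_real t * z)) integrable_on {0..1}"
    using absolutely_integrable_scaleR_continuous[OF \<omega> k1] set_lebesgue_integral_eq_integral(1) by blast
  have i2: "(\<lambda>t. \<omega> t * conv_kernel (1 / (1 - \<delta>)) (- (\<rho> * t))) integrable_on {0..1}"
    using absolutely_integrable_mult_continuous[OF \<omega> k2] set_lebesgue_integral_eq_integral(1) by blast
  have i3: "((\<lambda>t. \<omega> t * Re (conv_kernel c (of_real t * z))) has_integral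
      Re (integral {0..1} (\<lambda>t. \<omega> t *\<^sub>R conv_kernel c (of_real t * z)))) {0..1}"
    using has_integral_linear[OF integrable_integral[OF i1] bounded_linear_Re] by (simp add: o_def)
  have i4: "((\<lambda>t. \<omega> t * X t) has_integral (Re (integral {0..1} (\<lambda>t. \<omega> t *\<^sub>R conv_kernel c (of_real t * z)))
      - integral {0..1} (\<lambda>t. \<omega> t * conv_kernel (1 / (1 - \<delta>)) (- (\<rho> * t))))) {0..1}"
    using has_integral_diff[OF i3 integrable_integral[OF i2]] by (simp add: X_def right_diff_distrib)
  have "0 \<le> C * integral {0..1} (\<lambda>t. \<psi> t * S' t)" using C0 int by simp
  also have "\<dots> \<le> Re (integral {0..1} (\<lambda>t. \<omega> t *\<^sub>R conv_kernel c (of_real t * z)))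
      - integral {0..1} (\<lambda>t. \<omega> t * conv_kernel (1 / (1 - \<delta>)) (- (\<rho> * t)))"
    by (rule has_integral_le[OF has_integral_mult_right[OF integrable_integral[OF int(1)]] i4 point])
  finally show ?thesis by (simp add: c_def \<rho>_def)
qed

text \<open>The difference of the integrands is non-negative, so a positive contribution from one
  interval suffices. On [1/4, 1/2] the kernel gap has a positive minimum by continuity, and
  monotonicity carries the positivity of \<omega> from 1/2 to the left.\<close>

lemma weighted_kernel_integral_strict:
  fixes \<omega> :: "real \<Rightarrow> real"
  assumes \<omega>: "\<omega> absolutely_integrable_on {0..1}" and nonneg: "\<And>t. t \<in> {0..1} \<Longrightarrow> \<omega> t \<ge> 0"
    and mono: "\<And>s t. 0 < s \<Longrightarrow> s \<le> t \<Longrightarrow> t < 1 \<Longrightarrow>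
      \<omega> t / ((1 + t) * (1 - t) powr (1 + 2 * \<delta>)) \<le> \<omega> s / ((1 + s) * (1 - s) powr (1 + 2 * \<delta>))"
    and pos: "\<omega> (1/2) > 0"
    and \<delta>: "0 \<le> \<delta>" "\<delta> \<le> 1/2" and \<rho>: "0 \<le> \<rho>" "\<rho> < 1"
  shows "integral {0..1} (\<lambda>t. \<omega> t * conv_kernel (1 / (1 - \<delta>)) (- t))
    < integral {0..1} (\<lambda>t. \<omega> t * conv_kernel (1 / (1 - \<delta>)) (- (\<rho> * t)))"
proof -
  define g where "g = (\<lambda>t::real. conv_kernel (1 / (1 - \<delta>)) (- t))"
  have gc: "continuous_on {0..1} g"
    unfolding g_def conv_kernel_def by (intro continuous_intros) force+
  have \<rho>1: "\<rho> * t \<in> {0..1}" if "t \<in> {0..1}" for t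
    using that \<rho> by (auto intro: mult_le_one)
  have gc2: "continuous_on {0..1} (\<lambda>t. g (\<rho> * t))"
    by (rule continuous_on_compose2[OF gc]) (use \<rho>1 in \<open>auto intro!: continuous_on_mult continuous_on_id continuous_on_const\<close>)
  note gc3 = continuous_on_diff[OF gc2 gc]
  have I: "(\<lambda>t. \<omega> t * h t) integrable_on {0..1}" if "continuous_on {0..1} h" for h
    using absolutely_integrable_mult_continuous[OF \<omega> that] set_lebesgue_integral_eq_integral(1) by blast
  have d: "g (\<rho> * t) - g t \<ge> 0" if "t \<in> {0..1}" for t
  proof (cases "t = 0")
    case False
    then show ?thesis unfolding g_def
      using conv_kernel_strict_decreasing[of "\<rho> * t" t \<delta>] that \<rho> \<rho>1[OF that] \<delta> by auto
  qed simp
  have "continuous_on {1/4..1/2} (\<lambda>t. g (\<rho> * t) - g t)"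
    by (rule continuous_on_subset[OF gc3]) auto
  then obtain t0 where t0: "t0 \<in> {1/4..1/2}" and m: "\<And>t. t \<in> {1/4..1/2} \<Longrightarrow> g (\<rho> * t0) - g t0 \<le> g (\<rho> * t) - g t"
    using continuous_attains_inf[of "{1/4..1/2}" "\<lambda>t. g (\<rho> * t) - g t"] by auto
  have "\<rho> * t0 < t0" using t0 \<rho> by auto
  then have m0: "g (\<rho> * t0) - g t0 > 0"
    using conv_kernel_strict_decreasing[of "\<rho> * t0" t0 \<delta>] t0 \<rho> \<delta> unfolding g_def by auto
  \<comment> \<open>The last factor is a lower bound for (1 + t)(1 - t) powr (1 + 2 \<delta>) on
    [1/4, 1/2], so \<open>A\<close> bounds \<omega> from below there.\<close>
  define A where "A = \<omega> (1/2) / ((1 + 1/2) * (1 - 1/2) powr (1 + 2 * \<delta>)) * ((1/2) powr (1 + 2 * \<delta>))"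
  have A: "A > 0" using pos by (auto simp: A_def)
  have \<omega>A: "\<omega> t \<ge> A" if "t \<in> {1/4..1/2}" for t
  proof -
    have "\<omega> (1/2) / ((1 + 1/2) * (1 - 1/2) powr (1 + 2 * \<delta>)) \<le> \<omega> t / ((1 + t) * (1 - t) powr (1 + 2 * \<delta>))"
      using that by (intro mono) auto
    then have "A \<le> \<omega> t / ((1 + t) * (1 - t) powr (1 + 2 * \<delta>)) * ((1/2) powr (1 + 2 * \<delta>))"
      unfolding A_def by (rule mult_right_mono) auto
    also have "\<dots> = \<omega> t * ((1/2) powr (1 + 2 * \<delta>) / ((1 + t) * (1 - t) powr (1 + 2 * \<delta>)))" by simp
    also have "\<dots> \<le> \<omega> t * 1"
    proof (rule mult_left_mono)
      have "1 * (1/2) powr (1 + 2 * \<delta>) \<le> (1 + t) * (1 - t) powr (1 + 2 * \<delta>)"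
        using that \<delta> by (intro mult_mono powr_mono2) auto
      then show "(1/2) powr (1 + 2 * \<delta>) / ((1 + t) * (1 - t) powr (1 + 2 * \<delta>)) \<le> 1"
        using that by (simp add: divide_le_eq_1)
      show "0 \<le> \<omega> t" using that nonneg by auto
    qed
    finally show ?thesis by simp
  qed
  have "0 < integral {1/4..1/2::real} (\<lambda>_. A * (g (\<rho> * t0) - g t0))"
    using A m0 by simp
  also have "\<dots> \<le> integral {1/4..1/2} (\<lambda>t. \<omega> t * (g (\<rho> * t) - g t))"
  proof (rule integral_le)
    show "(\<lambda>t. \<omega> t * (g (\<rho> * t) - g t)) integrable_on {1/4..1/2}"
      by (rule integrable_on_subinterval[OF I[OF gc3]]) auto
    show "A * (g (\<rho> * t0) - g t0) \<le> \<omega> t * (g (\<rho> * t) - g t)" if "t \<in> {1/4..1/2}" for t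
      using \<omega>A[OF that] m[OF that] m0 A by (intro mult_mono) auto
  qed auto
  also have "\<dots> \<le> integral {0..1} (\<lambda>t. \<omega> t * (g (\<rho> * t) - g t))"
  proof (rule integral_subset_le)
    show "(\<lambda>t. \<omega> t * (g (\<rho> * t) - g t)) integrable_on {1/4..1/2}"
      by (rule integrable_on_subinterval[OF I[OF gc3]]) auto
  qed (use I[OF gc3] nonneg d in auto)
  also have "\<dots> = integral {0..1} (\<lambda>t. \<omega> t * g (\<rho> * t)) - integral {0..1} (\<lambda>t. \<omega> t * g t)"
    using integral_diff[OF I[OF gc2] I[OF gc]] by (simp add: right_diff_distrib)
  finally show ?thesis by (simp add: g_def)
qed

section \<open>Moments of tail integrals\<close>

text \<open>Away from 0 the factor x powr s can be divided out. This has to be known because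
  \<open>integral\<close> defaults to 0 on non-integrable functions, so a tail carries information
  only once integrability is established.\<close>

lemma tail_integral_integrable:
  fixes \<phi> :: "real \<Rightarrow> real"
  assumes nonneg: "\<And>x. 0 < x \<Longrightarrow> x \<le> 1 \<Longrightarrow> \<phi> x \<ge> 0"
    and int: "(\<lambda>x. \<phi> x * x powr s) integrable_on {0..1}" and t: "0 < t"
  shows "\<phi> integrable_on {t..1}"
proof -
  have "(\<lambda>x. \<phi> x * x powr s) integrable_on {t..1}"
    by (rule integrable_on_subinterval[OF int]) (use t in auto)
  then have "(\<lambda>x. \<phi> x * x powr s) absolutely_integrable_on {t..1}"
    by (intro nonnegative_absolutely_integrable_1) (use t nonneg in auto)
  then have "(\<lambda>x. \<phi> x * x powr s * x powr (- s)) absolutely_integrable_on {t..1}"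
    by (rule absolutely_integrable_mult_continuous) (use t in \<open>auto intro!: continuous_on_powr continuous_on_id continuous_on_const\<close>)
  then have "(\<lambda>x. \<phi> x * x powr s * x powr (- s)) integrable_on {t..1}"
    by (rule set_lebesgue_integral_eq_integral(1))
  then show ?thesis
    by (rule integrable_eq) (use t in \<open>auto simp: powr_minus field_simps\<close>)
qed

text \<open>Exchange of the order of integration on the triangle 0 < t \<le> x \<le> 1: the inner
  integral of t powr (s - 1) over [0, x] is x powr s / s. Non-negativity permits Tonelli, which
  yields integrability of the left side together with its value. It is applied twice, once for each
  level of nesting in \<open>Pi_mu_nu\<close>.\<close>

lemma tail_integral_moment:
  fixes \<phi> :: "real \<Rightarrow> real"
  assumes s: "s > 0" and nonneg: "\<And>x. 0 < x \<Longrightarrow> x \<le> 1 \<Longrightarrow> \<phi> x \<ge> 0"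
    and I: "((\<lambda>x. \<phi> x * x powr s) has_integral I) {0..1}"
  shows "((\<lambda>t. integral {t..1} \<phi> * t powr (s - 1)) has_integral I / s) {0..1}"
proof -
  define A where "A = (\<lambda>t. integral {t..1} \<phi>)"
  \<comment> \<open>The sign of \<phi> is known only on (0, 1], so its value at 0 is cut
    off.\<close>
  define \<phi>1 where "\<phi>1 = (\<lambda>x. indicator {0<..1} x * \<phi> x)"
  have \<phi>1_nonneg: "\<phi>1 x \<ge> 0" for x using nonneg by (auto simp: \<phi>1_def indicator_def)
  have "(\<lambda>x. indicator {0..1} x *\<^sub>R (\<phi> x * x powr s)) \<in> borel_measurable lebesgue"
    by (rule has_integral_implies_lebesgue_measurable[OF I])
  then have "(\<lambda>x. indicator {0..1} x *\<^sub>R (\<phi> x * x powr s) * x powr (- s)) \<in> borel_measurable lebesgue"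
    by (intro borel_measurable_times) (auto intro!: measurable_completion)
  also have "(\<lambda>x. indicator {0..1} x *\<^sub>R (\<phi> x * x powr s) * x powr (- s)) = \<phi>1"
    by (rule ext) (auto simp: \<phi>1_def indicator_def powr_minus field_simps)
  finally have "\<phi>1 \<in> borel_measurable (completion lborel)" .
  \<comment> \<open>Tonelli on the product requires Borel measurability, whereas \<phi>1 is only
    Lebesgue measurable; an almost everywhere equal Borel function takes its place.\<close>
  then obtain \<phi>2 where \<phi>2: "\<phi>2 \<in> borel_measurable lborel" and ae: "AE x in lborel. \<phi>1 x = \<phi>2 x"
    using completion_ex_borel_measurable_real by blast
  note [measurable] = \<phi>2
  define F where "F = (\<lambda>t x. indicator {0<..1} t * (indicator {t..1} x * ennreal (\<phi>2 x)) * ennreal (t powr (s - 1)))"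
  have F_meas [measurable]: "(\<lambda>(t, x). F t x) \<in> borel_measurable (lborel \<Otimes>\<^sub>M lborel)"
  proof -
    have "(\<lambda>(t, x). indicator {t..1} x :: ennreal) = (\<lambda>p. if fst p \<le> snd p \<and> snd p \<le> (1::real) then 1 else 0)"
      by (auto simp: indicator_def)
    then have [measurable]: "(\<lambda>(t, x::real). indicator {t..1} x :: ennreal) \<in> borel_measurable (lborel \<Otimes>\<^sub>M lborel)"
      by simp
    show ?thesis unfolding F_def by measurable
  qed
  have F1: "(\<integral>\<^sup>+x. F t x \<partial>lborel) = ennreal (indicator {0<..1} t * (A t * t powr (s - 1)))" for t
  proof (cases "t \<in> {0<..1}")
    case True
    then have "\<phi> integrable_on {t..1}"
      using tail_integral_integrable[OF nonneg has_integral_integrable[OF I]] by auto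
    then have "(\<integral>\<^sup>+x. ennreal (indicator {t..1} x * \<phi> x) \<partial>lborel) = ennreal (A t)"
      unfolding A_def using True nonneg
      by (intro nn_integral_has_integral_lebesgue integrable_integral) auto
    moreover have "(\<integral>\<^sup>+x. ennreal (indicator {t..1} x * \<phi> x) \<partial>lborel) = (\<integral>\<^sup>+x. indicator {t..1} x * ennreal (\<phi>2 x) \<partial>lborel)"
      by (rule nn_integral_cong_AE) (use ae True in \<open>auto simp: \<phi>1_def indicator_def elim!: AE_mp\<close>)
    moreover have "A t \<ge> 0" unfolding A_def
      using True nonneg \<open>\<phi> integrable_on {t..1}\<close> by (intro integral_nonneg) auto
    ultimately show ?thesis
      using True unfolding F_def
      by (simp add: nn_integral_multc ennreal_mult)
  qed (simp add: F_def)
  have F2: "(\<integral>\<^sup>+t. F t x \<partial>lborel) = ennreal (\<phi>2 x) * ennreal (indicator {0<..1} x * (x powr s / s))" for x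
  proof (cases "x \<in> {0<..1}")
    case True
    have "((\<lambda>t. t powr (s - 1)) has_integral (x powr s / s)) {0..x}"
      using has_integral_powr_from_0[of "s - 1" x] s True by simp
    then have "(\<integral>\<^sup>+t. ennreal (indicator {0..x} t * t powr (s - 1)) \<partial>lborel) = ennreal (x powr s / s)"
      by (intro nn_integral_has_integral_lebesgue) auto
    moreover have "F t x = ennreal (\<phi>2 x) * ennreal (indicator {0..x} t * t powr (s - 1))" for t
      using True by (auto simp: F_def indicator_def)
    ultimately show ?thesis using True by (simp add: nn_integral_cmult)
  next
    case False
    then have "F t x = 0" for t by (auto simp: F_def indicator_def)
    then show ?thesis using False by simp
  qed
  have nonneg': "\<phi> x * x powr s / s \<ge> 0" if "x \<in> {0..1}" for x
    using that nonneg[of x] s by (cases "x = 0") auto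
  define J where "J = (\<lambda>t. indicator {0<..1} t * (A t * t powr (s - 1)))"
  have A0: "A t \<ge> 0" if "t \<in> {0<..1}" for t
    unfolding A_def using that nonneg tail_integral_integrable[OF nonneg has_integral_integrable[OF I]]
    by (intro integral_nonneg) auto
  have J0: "J t \<ge> 0" for t using A0 by (auto simp: J_def indicator_def)
  have I0: "I \<ge> 0"
    by (rule has_integral_nonneg[OF I]) (use nonneg in \<open>force simp: le_less\<close>)
  have "(\<integral>\<^sup>+t. ennreal (J t) \<partial>lborel) = (\<integral>\<^sup>+t. \<integral>\<^sup>+x. F t x \<partial>lborel \<partial>lborel)"
    by (simp add: F1 J_def)
  also have "\<dots> = (\<integral>\<^sup>+x. \<integral>\<^sup>+t. F t x \<partial>lborel \<partial>lborel)"
    by (rule lborel_pair.Fubini'[symmetric]) (rule F_meas)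
  also have "\<dots> = (\<integral>\<^sup>+x. ennreal (indicator {0..1} x * (\<phi> x * x powr s / s)) \<partial>lborel)"
    unfolding F2
  proof (rule nn_integral_cong_AE)
    show "AE x in lborel. ennreal (\<phi>2 x) * ennreal (indicator {0<..1} x * (x powr s / s))
        = ennreal (indicator {0..1} x * (\<phi> x * x powr s / s))"
      using ae
    proof (rule AE_mp, intro AE_I2 impI)
      fix x assume "\<phi>1 x = \<phi>2 x"
      then show "ennreal (\<phi>2 x) * ennreal (indicator {0<..1} x * (x powr s / s))
        = ennreal (indicator {0..1} x * (\<phi> x * x powr s / s))"
        using nonneg[of x] s by (cases "x = 0") (auto simp: \<phi>1_def indicator_def simp flip: ennreal_mult)
    qed
  qed
  also have "\<dots> = ennreal (I / s)"
    by (rule nn_integral_has_integral_lebesgue[OF nonneg' has_integral_divide[OF I]])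
  finally have eq: "(\<integral>\<^sup>+t. ennreal (J t) \<partial>lborel) = ennreal (I / s)" .
  have "(\<lambda>t. enn2real (\<integral>\<^sup>+x. F t x \<partial>lborel)) \<in> borel_measurable lborel"
    by measurable
  then have Jm: "J \<in> borel_measurable lebesgue"
    unfolding F1 using J0 by (intro measurable_completion) (simp add: J_def)
  have "(J has_integral I / s) UNIV"
    unfolding has_integral_iff_nn_integral_lebesgue[OF J0]
    using Jm eq I0 s by (simp add: nn_integral_completion)
  also have "J = (\<lambda>t. if t \<in> {0..1} then A t * t powr (s - 1) else 0)"
    by (rule ext) (auto simp: J_def indicator_def)
  finally show ?thesis
    unfolding has_integral_restrict_UNIV A_def .
qed

subsection \<open>Real part of a Hadamard product\<close>

lemma integral_sums:
  fixes h :: "nat \<Rightarrow> real \<Rightarrow> complex"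
  assumes c: "\<And>m. continuous_on {a..b} (h m)" and B: "\<And>m t. t \<in> {a..b} \<Longrightarrow> norm (h m t) \<le> B m"
    and s: "summable B"
  shows "(\<lambda>m. integral {a..b} (h m)) sums integral {a..b} (\<lambda>t. \<Sum>m. h m t)"
proof -
  have i: "h m integrable_on {a..b}" for m using c by (rule integrable_continuous_real)
  have S: "((\<lambda>t. \<Sum>m<n. h m t) has_integral (\<Sum>m<n. integral {a..b} (h m))) {a..b}" for n
    by (intro has_integral_sum integrable_integral i) auto
  have sh: "summable (\<lambda>m. norm (h m t))" if "t \<in> {a..b}" for t
    by (rule summable_comparison_test'[OF s, of 0]) (use B[OF that] in auto)
  have le: "norm (\<Sum>m<n. h m t) \<le> suminf B" if "t \<in> {a..b}" for t n
  proof -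
    have "norm (\<Sum>m<n. h m t) \<le> (\<Sum>m<n. B m)" by (intro sum_norm_le B that)
    also have "\<dots> \<le> suminf B"
      by (rule sum_le_suminf[OF s]) (use order_trans[OF norm_ge_zero B[OF that]] in auto)
    finally show ?thesis .
  qed
  have lim: "(\<lambda>n. \<Sum>m<n. h m t) \<longlonglongrightarrow> (\<Sum>m. h m t)" if "t \<in> {a..b}" for t
    by (rule summable_LIMSEQ[OF summable_norm_cancel[OF sh[OF that]]])
  show ?thesis
    using dominated_convergence(2)[OF has_integral_integrable[OF S] integrable_const_ivl le lim]
    unfolding sums_def integral_unique[OF S] .
qed

lemma integral_cis_period:
  "integral {0..2 * pi} (\<lambda>\<theta>. cis (of_int j * \<theta>)) = (if j = 0 then of_real (2 * pi) else 0)"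
proof (cases "j = 0")
  case False
  define F where "F = (\<lambda>\<theta>::real. cis (of_int j * \<theta>) / (\<i> * of_int j))"
  have "(F has_vector_derivative cis (of_int j * \<theta>)) (at \<theta> within {0..2 * pi})" for \<theta>
  proof -
    have "((\<lambda>z. exp (\<i> * of_int j * z) / (\<i> * of_int j)) has_field_derivative exp (\<i> * of_int j * of_real \<theta>)) (at (of_real \<theta>))"
      using False by (auto intro!: derivative_eq_intros)
    from has_vector_derivative_real_field[OF this]
    show ?thesis unfolding F_def by (simp add: cis_conv_exp mult_ac)
  qed
  then have "((\<lambda>\<theta>. cis (of_int j * \<theta>)) has_integral (F (2 * pi) - F 0)) {0..2 * pi}"
    by (intro fundamental_theorem_of_calculus) auto
  moreover have "cis (of_int j * (2 * pi)) = 1"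
    by (metis cis_multiple_2pi Ints_of_int mult.commute mult.left_commute)
  then have "F (2 * pi) = F 0" by (simp add: F_def)
  ultimately show ?thesis using False by (simp add: integral_unique)
qed (simp add: scaleR_conv_of_real)

lemma summable_norm_power_series:
  fixes q :: "nat \<Rightarrow> complex"
  assumes "\<And>w. norm w < 1 \<Longrightarrow> (\<lambda>m. q m * w ^ m) sums Q w" and "norm w < 1"
  shows "summable (\<lambda>m. norm (q m * w ^ m))"
proof -
  obtain r where r: "norm w < r" "r < 1" using assms(2) dense by blast
  then have "norm (of_real r :: complex) < 1" using norm_ge_zero[of w] by (simp del: norm_ge_zero)
  then have "summable (\<lambda>m. q m * of_real r ^ m)" using assms(1) sums_summable by blast
  then show ?thesis by (rule powser_insidea) (use r norm_ge_zero[of w] in \<open>simp del: norm_ge_zero\<close>)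
qed

lemma continuous_on_power_series:
  fixes q :: "nat \<Rightarrow> complex"
  assumes "\<And>w. norm w < 1 \<Longrightarrow> (\<lambda>m. q m * w ^ m) sums Q w"
  shows "continuous_on (ball 0 1) Q"
  by (rule holomorphic_on_imp_continuous_on, rule power_series_holomorphic) (use assms in auto)

text \<open>With z = \<rho> v, the mean of 2 Re Q(\<rho> e^(i\<theta>)) K(v e^(-i\<theta>)) over a
  period is L + cnj (q 0), since the conjugate part of 2 Re Q contributes only its constant term.
  Subtracting c0 times the mean of 2 Re Q and taking real parts leaves the mean of 2 Re Q (Re K -
  c0), a product of positive functions.\<close>

lemma Re_hadamard_product_gt:
  fixes q k :: "nat \<Rightarrow> complex" and Q K :: "complex \<Rightarrow> complex" and c0 :: real
  assumes Q: "\<And>w. norm w < 1 \<Longrightarrow> (\<lambda>m. q m * w ^ m) sums Q w"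
    and K: "\<And>w. norm w < 1 \<Longrightarrow> (\<lambda>m. k m * w ^ m) sums K w"
    and Qpos: "\<And>w. norm w < 1 \<Longrightarrow> Re (Q w) > 0" and Kgt: "\<And>w. norm w < 1 \<Longrightarrow> Re (K w) > c0"
    and k0: "k 0 = 1" and z: "norm z < 1" and L: "(\<lambda>m. q m * k m * z ^ m) sums L"
  shows "Re L + Re (q 0) > 2 * c0 * Re (q 0)"
proof -
  \<comment> \<open>A radius strictly between |z| and 1 keeps both arguments, of modulus \<rho> and
    |z| / \<rho>, inside the disc.\<close>
  obtain \<rho> where \<rho>: "norm z < \<rho>" "\<rho> < 1" using z dense by blast
  then have \<rho>0: "\<rho> > 0" using norm_ge_zero[of z] by linarith
  define v where "v = z / of_real \<rho>"
  have v: "norm v < 1" "of_real \<rho> * v = z" using \<rho> \<rho>0 by (auto simp: v_def norm_divide)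
  define P where "P = (\<lambda>\<theta>. Q (of_real \<rho> * cis \<theta>))"
  define R where "R = (\<lambda>\<theta>. K (v * cis (- \<theta>)))"
  define U where "U = (\<lambda>\<theta>. P \<theta> + cnj (P \<theta>))"
  let ?I = "{0..2 * pi}"
  have in1: "norm (of_real \<rho> * cis \<theta>) < 1" "norm (v * cis (- \<theta>)) < 1" for \<theta>
    using \<rho> \<rho>0 v by (simp_all add: norm_mult)
  have Pc: "continuous_on ?I P" unfolding P_def
    by (rule continuous_on_compose2[OF continuous_on_power_series[OF Q]]) (use in1 in \<open>auto intro!: continuous_intros\<close>)
  have Rc: "continuous_on ?I R" unfolding R_def
    by (rule continuous_on_compose2[OF continuous_on_power_series[OF K]]) (use in1 in \<open>auto intro!: continuous_intros\<close>)
  have Uc: "continuous_on ?I U" unfolding U_def by (intro continuous_on_add continuous_on_cnj Pc)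
  have sq: "summable (\<lambda>m. norm (q m * of_real \<rho> ^ m))"
    using summable_norm_power_series[OF Q, of "of_real \<rho>"] \<rho> \<rho>0 by simp
  have sk: "summable (\<lambda>m. norm (k m * v ^ m))"
    by (rule summable_norm_power_series[OF K v(1)])
  have Ps: "P \<theta> = (\<Sum>m. q m * of_real \<rho> ^ m * cis (real m * \<theta>))" for \<theta>
    unfolding P_def using sums_unique[OF Q[OF in1(1)[of \<theta>]]]
    by (simp add: power_mult_distrib Complex.DeMoivre mult.assoc)
  have Psum: "summable (\<lambda>m. q m * of_real \<rho> ^ m * cis (real m * \<theta>))" for \<theta>
    by (rule summable_norm_cancel) (use sq in \<open>simp add: norm_mult\<close>)
  have Rs: "R \<theta> = (\<Sum>m. k m * v ^ m * cis (- (real m * \<theta>)))" for \<theta>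
    unfolding R_def using sums_unique[OF K[OF in1(2)[of \<theta>]]]
    by (simp add: power_mult_distrib Complex.DeMoivre mult.assoc)
  have Rsum: "summable (\<lambda>m. k m * v ^ m * cis (- (real m * \<theta>)))" for \<theta>
    by (rule summable_norm_cancel) (use sk in \<open>simp add: norm_mult\<close>)
  have cP: "integral ?I (\<lambda>\<theta>. P \<theta> * cis (- (real n * \<theta>))) = 2 * pi * (q n * of_real \<rho> ^ n)" for n
  proof -
    let ?h = "\<lambda>m \<theta>. q m * of_real \<rho> ^ m * cis (of_int (int m - int n) * \<theta>)"
    have h: "(\<Sum>m. ?h m \<theta>) = P \<theta> * cis (- (real n * \<theta>))" for \<theta>
      unfolding Ps suminf_mult2[OF Psum]
      by (rule suminf_cong) (simp add: cis_mult mult.assoc algebra_simps)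
    have "(\<lambda>m. integral ?I (?h m)) sums integral ?I (\<lambda>\<theta>. \<Sum>m. ?h m \<theta>)"
      by (rule integral_sums[OF _ _ sq]) (auto intro!: continuous_intros simp: norm_mult)
    moreover have "integral ?I (?h m) = (if m = n then 2 * pi * (q n * of_real \<rho> ^ n) else 0)" for m
      unfolding integral_mult_right integral_cis_period by auto
    ultimately have "(\<lambda>m. if m = n then 2 * pi * (q n * of_real \<rho> ^ n) else 0) sums integral ?I (\<lambda>\<theta>. P \<theta> * cis (- (real n * \<theta>)))"
      unfolding h by simp
    from sums_unique2[OF this sums_single[of n "\<lambda>_. 2 * pi * (q n * of_real \<rho> ^ n)"]] show ?thesis .
  qed
  \<comment> \<open>The frequencies occurring are -(m + n), and only m = n = 0 gives zero.\<close>
  have cP': "integral ?I (\<lambda>\<theta>. cnj (P \<theta>) * cis (- (real n * \<theta>))) = (if n = 0 then 2 * pi * cnj (q 0) else 0)" for n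
  proof -
    let ?h = "\<lambda>m \<theta>. cnj (q m * of_real \<rho> ^ m) * cis (of_int (- int m - int n) * \<theta>)"
    have cs: "(\<lambda>m. cnj (q m * of_real \<rho> ^ m * cis (real m * \<theta>))) sums cnj (P \<theta>)" for \<theta>
      unfolding sums_cnj Ps by (rule summable_sums[OF Psum])
    have h: "(\<Sum>m. ?h m \<theta>) = cnj (P \<theta>) * cis (- (real n * \<theta>))" for \<theta>
      unfolding sums_unique[OF cs] suminf_mult2[OF sums_summable[OF cs]]
      by (rule suminf_cong) (simp add: cis_mult cis_cnj mult.assoc algebra_simps)
    have "(\<lambda>m. integral ?I (?h m)) sums integral ?I (\<lambda>\<theta>. \<Sum>m. ?h m \<theta>)"
      by (rule integral_sums[OF _ _ sq]) (auto intro!: continuous_intros simp: norm_mult norm_power)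
    moreover have "integral ?I (?h m) = (if m = 0 then (if n = 0 then 2 * pi * cnj (q 0) else 0) else 0)" for m
      unfolding integral_mult_right integral_cis_period by auto
    ultimately have "(\<lambda>m. if m = 0 then (if n = 0 then 2 * pi * cnj (q 0) else 0) else 0) sums integral ?I (\<lambda>\<theta>. cnj (P \<theta>) * cis (- (real n * \<theta>)))"
      unfolding h by simp
    from sums_unique2[OF this sums_single[of 0 "\<lambda>_. (if n = 0 then 2 * pi * cnj (q 0) else 0)"]] show ?thesis .
  qed
  have ci: "(\<lambda>\<theta>. P \<theta> * cis (- (real n * \<theta>))) integrable_on ?I"
    "(\<lambda>\<theta>. cnj (P \<theta>) * cis (- (real n * \<theta>))) integrable_on ?I" for n
    by (rule integrable_continuous_real, intro continuous_intros Pc)+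
  have cU: "integral ?I (\<lambda>\<theta>. U \<theta> * cis (- (real n * \<theta>))) = 2 * pi * (q n * of_real \<rho> ^ n + (if n = 0 then cnj (q 0) else 0))" for n
    unfolding U_def distrib_right integral_add[OF ci] cP cP' by (simp add: distrib_left)
  obtain B where B: "\<forall>x\<in>U ` ?I. norm x \<le> B"
    using compact_imp_bounded[OF compact_continuous_image[OF Uc compact_Icc]] unfolding bounded_iff by blast
  have int: "integral ?I (\<lambda>\<theta>. U \<theta> * R \<theta>) = 2 * pi * (L + cnj (q 0))"
  proof -
    let ?h = "\<lambda>n \<theta>. k n * v ^ n * (U \<theta> * cis (- (real n * \<theta>)))"
    have h: "(\<Sum>n. ?h n \<theta>) = U \<theta> * R \<theta>" for \<theta>
      unfolding Rs suminf_mult[OF Rsum, symmetric] by (rule suminf_cong) (simp add: mult_ac)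
    have "(\<lambda>n. integral ?I (?h n)) sums integral ?I (\<lambda>\<theta>. \<Sum>n. ?h n \<theta>)"
    proof (rule integral_sums)
      show "continuous_on ?I (?h n)" for n by (intro continuous_intros Uc)
      show "summable (\<lambda>n. norm (k n * v ^ n) * B)" by (rule summable_mult2[OF sk])
      show "norm (?h n \<theta>) \<le> norm (k n * v ^ n) * B" if "\<theta> \<in> ?I" for n \<theta>
        unfolding norm_mult[of "k n * v ^ n"] using B that by (intro mult_left_mono) (auto simp: norm_mult)
    qed
    then have 1: "(\<lambda>n. k n * v ^ n * (2 * pi * (q n * of_real \<rho> ^ n + (if n = 0 then cnj (q 0) else 0)))) sums integral ?I (\<lambda>\<theta>. U \<theta> * R \<theta>)"
      unfolding h integral_mult_right cU .
    have "(\<lambda>n. if n = 0 then cnj (q 0) else 0) sums cnj (q 0)"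
      using sums_single[of 0 "\<lambda>_. cnj (q 0)"] by simp
    from sums_mult[OF sums_add[OF L this], of "2 * pi"]
    have "(\<lambda>n. 2 * pi * (q n * k n * z ^ n + (if n = 0 then cnj (q 0) else 0))) sums (2 * pi * (L + cnj (q 0)))" .
    also have "(\<lambda>n. 2 * pi * (q n * k n * z ^ n + (if n = 0 then cnj (q 0) else 0)))
        = (\<lambda>n. k n * v ^ n * (2 * pi * (q n * of_real \<rho> ^ n + (if n = 0 then cnj (q 0) else 0))))"
      unfolding v(2)[symmetric] by (rule ext) (simp add: k0 algebra_simps power_mult_distrib)
    finally show ?thesis by (rule sums_unique2[OF 1])
  qed
  have int0: "integral ?I U = 2 * pi * (q 0 + cnj (q 0))"
    using cU[of 0] by simp
  define W where "W = (\<lambda>\<theta>. 2 * Re (P \<theta>) * (Re (R \<theta>) - c0))"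
  have W: "W = (\<lambda>\<theta>. Re (U \<theta> * R \<theta> - of_real c0 * U \<theta>))"
    by (rule ext) (simp add: W_def U_def algebra_simps)
  have i: "(\<lambda>\<theta>. U \<theta> * R \<theta>) integrable_on ?I" "U integrable_on ?I"
    by (rule integrable_continuous_real, intro continuous_intros Uc Rc)+
  have hi: "((\<lambda>\<theta>. U \<theta> * R \<theta> - of_real c0 * U \<theta>) has_integral (2 * pi * (L + cnj (q 0)) - of_real c0 * (2 * pi * (q 0 + cnj (q 0))))) ?I"
    by (rule has_integral_diff[OF integrable_integral[OF i(1), unfolded int]
          has_integral_mult_right[OF integrable_integral[OF i(2), unfolded int0]]])
  have "(W has_integral Re (2 * pi * (L + cnj (q 0)) - of_real c0 * (2 * pi * (q 0 + cnj (q 0))))) ?I"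
    using has_integral_linear[OF hi bounded_linear_Re] unfolding W o_def .
  moreover have "Re (2 * pi * (L + cnj (q 0)) - of_real c0 * (2 * pi * (q 0 + cnj (q 0)))) = 2 * pi * (Re L + Re (q 0) - 2 * c0 * Re (q 0))"
    by (simp add: algebra_simps)
  ultimately have hW: "(W has_integral 2 * pi * (Re L + Re (q 0) - 2 * c0 * Re (q 0))) ?I" by simp
  have Wc: "continuous_on ?I W" unfolding W_def by (intro continuous_intros Pc Rc)
  \<comment> \<open>The minimum over the compact period is positive, which makes the inequality for
    the integral strict.\<close>
  obtain \<theta>0 where "\<forall>\<theta>\<in>?I. W \<theta>0 \<le> W \<theta>"
    using continuous_attains_inf[OF compact_Icc _ Wc] by auto
  then have \<theta>0: "W \<theta>0 \<le> W \<theta>" if "\<theta> \<in> ?I" for \<theta>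
    using that by blast
  have Wpos: "W \<theta>0 > 0"
    using Qpos[OF in1(1)[of \<theta>0]] Kgt[OF in1(2)[of \<theta>0]] by (simp add: W_def P_def R_def)
  have "((\<lambda>_. W \<theta>0) has_integral (2 * pi * W \<theta>0)) ?I"
    using has_integral_const_real[of "W \<theta>0" 0 "2 * pi"] by simp
  from has_integral_le[OF this hW \<theta>0]
  have "2 * pi * W \<theta>0 \<le> 2 * pi * (Re L + Re (q 0) - 2 * c0 * Re (q 0))" by simp
  then have "W \<theta>0 \<le> Re L + Re (q 0) - 2 * c0 * Re (q 0)" by simp
  then show ?thesis using Wpos by linarith
qed

subsection \<open>Power series of the function q\<close>

lemma conv_kernel_sums:
  fixes w c :: "'a::{real_normed_field,banach}"
  assumes "norm w < 1"
  shows "(\<lambda>n. (1 + c * of_nat n) * w ^ n) sums conv_kernel c w"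
proof -
  have w: "1 - w \<noteq> 0" using assms by auto
  have "(\<lambda>n. (1 - c) * w ^ n + c * (of_nat (Suc n) * w ^ n)) sums ((1 - c) * (1 / (1 - w)) + c * (1 / (1 - w)\<^sup>2))"
    by (intro sums_add sums_mult geometric_sums geometric_deriv_sums assms)
  moreover have "(1 - c) * (1 / (1 - w)) + c * (1 / (1 - w)\<^sup>2) = conv_kernel c w"
    using w by (simp add: conv_kernel_def divide_simps power2_eq_square) (simp add: algebra_simps)
  moreover have "(\<lambda>n. (1 - c) * w ^ n + c * (of_nat (Suc n) * w ^ n)) = (\<lambda>n. (1 + c * of_nat n) * w ^ n)"
    by (rule ext) (simp add: algebra_simps)
  ultimately show ?thesis by simp
qed

text \<open>The rational factor in the integrand of q, in the single variable u = s w t. It is the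
  derivative of x g(x) at x = -u, where g is \<open>conv_kernel\<close> with c = 1 / (1 - \<delta>);
  this links q to the kernel for \<epsilon> = 1.\<close>

definition q_kernel :: "real \<Rightarrow> real \<Rightarrow> real" where
  "q_kernel \<delta> u = ((1 - \<delta>) - (1 + \<delta>) * u) / ((1 - \<delta>) * (1 + u) ^ 3)"

definition q_coeff :: "real \<Rightarrow> nat \<Rightarrow> real" where
  "q_coeff \<delta> m = real (Suc m) * (1 + 1 / (1 - \<delta>) * real m)"

lemma q_kernel_sums:
  fixes u :: real
  assumes u: "\<bar>u\<bar> < 1" and \<delta>: "\<delta> < 1"
  shows "(\<lambda>m. q_coeff \<delta> m * (- u) ^ m) sums q_kernel \<delta> u"
proof -
  define c where "c = 1 / (1 - \<delta>)"
  \<comment> \<open>The coefficients of x g(x): the extra factor x shifts those of g by one, and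
    termwise differentiation then brings in m + 1.\<close>
  define b where "b = (\<lambda>n. case n of 0 \<Rightarrow> 0 | Suc m \<Rightarrow> 1 + c * real m)"
  have bs: "(\<lambda>n. b n * x ^ n) sums (x * conv_kernel c x)" if "norm x < 1" for x :: real
  proof -
    have "(\<lambda>n. b (Suc n) * x ^ Suc n) sums (x * conv_kernel c x)"
      using sums_mult[OF conv_kernel_sums[OF that, of c], of x] by (simp add: b_def mult_ac)
    then show ?thesis using sums_Suc[of "\<lambda>n. b n * x ^ n" "x * conv_kernel c x"] by (simp add: b_def)
  qed
  have n0: "1 + u \<noteq> 0" "1 - \<delta> \<noteq> 0" using u \<delta> by auto
  have "((\<lambda>x. x * conv_kernel c x) has_real_derivative q_kernel \<delta> u) (at (- u))"
  proof -
    have "((\<lambda>x. x * (1 / (1 - x) + c * x / (1 - x)\<^sup>2)) has_real_derivative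
        (1 / (1 + u) - c * u / (1 + u)\<^sup>2) + (- u) * (1 / (1 + u)\<^sup>2 + (c * (1 + u)\<^sup>2 - 2 * c * u * (1 + u)) / (1 + u) ^ 4)) (at (- u))"
      by (rule derivative_eq_intros refl | (use n0 in simp; fail))+
        (use n0 in \<open>simp add: power2_eq_square power4_eq_xxxx algebra_simps\<close>)
    moreover have "(1 / (1 + u) - c * u / (1 + u)\<^sup>2) + (- u) * (1 / (1 + u)\<^sup>2 + (c * (1 + u)\<^sup>2 - 2 * c * u * (1 + u)) / (1 + u) ^ 4) = q_kernel \<delta> u"
    proof -
      \<comment> \<open>The identity becomes polynomial in \<open>g\<close>, \<open>c\<close>, u and
        \<delta> modulo the relations g (1 + u) = 1 and c (1 - \<delta>) = 1.\<close>
      define g where "g = 1 / (1 + u)"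
      have g: "g * (1 + u) = 1" using n0 by (simp add: g_def)
      have c: "c * (1 - \<delta>) = 1" using n0 by (simp add: c_def)
      have "q_kernel \<delta> u = c * ((1 - \<delta>) - (1 + \<delta>) * u) * g ^ 3"
        by (simp add: q_kernel_def c_def g_def power_divide)
      moreover have "(1 / (1 + u) - c * u / (1 + u)\<^sup>2) + (- u) * (1 / (1 + u)\<^sup>2 + (c * (1 + u)\<^sup>2 - 2 * c * u * (1 + u)) / (1 + u) ^ 4)
        = (g - c * u * g\<^sup>2) + (- u) * (g\<^sup>2 + (c * (1 + u)\<^sup>2 - 2 * c * u * (1 + u)) * g ^ 4)"
        by (simp add: g_def power_divide)
      moreover have "(g - c * u * g\<^sup>2) + (- u) * (g\<^sup>2 + (c * (1 + u)\<^sup>2 - 2 * c * u * (1 + u)) * g ^ 4)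
        = c * ((1 - \<delta>) - (1 + \<delta>) * u) * g ^ 3"
        using g c by algebra
      ultimately show ?thesis by simp
    qed
    ultimately show ?thesis unfolding conv_kernel_def by simp
  qed
  from termdiffs_sums_strong[OF bs this] u
  have "(\<lambda>n. diffs b n * (- u) ^ n) sums q_kernel \<delta> u" by simp
  moreover have "diffs b = q_coeff \<delta>"
    by (rule ext) (simp add: diffs_def b_def q_coeff_def c_def)
  ultimately show ?thesis by simp
qed

lemma powr_moment:
  fixes a :: real
  assumes "a > 0"
  shows "((\<lambda>s. s powr (1 / a - 1) * s ^ m) has_integral a / (1 + a * real m)) {0..1}"
proof -
  have "((\<lambda>s. s powr (1 / a - 1 + real m)) has_integral 1 / (1 / a + real m)) {0..1}"
    using has_integral_powr_from_0[of "1 / a - 1 + real m" 1] assms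
    by (simp add: add_nonneg_pos algebra_simps)
  moreover have "1 / (1 / a + real m) = a / (1 + a * real m)"
    using assms by (simp add: field_simps)
  ultimately have "((\<lambda>s. s powr (1 / a - 1 + real m)) has_integral a / (1 + a * real m)) {0..1}" by simp
  then show ?thesis
    by (rule has_integral_spike_finite[of "{0}", rotated 2]) (auto simp: powr_add powr_realpow)
qed

lemma absolutely_integrable_powr:
  fixes a :: real
  assumes "a > 0"
  shows "(\<lambda>s. s powr (1 / a - 1)) absolutely_integrable_on {0..1}"
  using has_integral_integrable[OF powr_moment[OF assms, of 0]]
  by (intro nonnegative_absolutely_integrable_1) auto

lemma powr_integral_series:
  fixes a :: real and b :: "nat \<Rightarrow> real"
  assumes a: "a > 0" and b: "summable (\<lambda>m. \<bar>b m\<bar>)"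
    and g: "\<And>s. 0 \<le> s \<Longrightarrow> s \<le> 1 \<Longrightarrow> g s = (\<Sum>m. s ^ m * b m)"
  shows "((\<lambda>s. g s * s powr (1 / a - 1)) has_integral (\<Sum>m. a / (1 + a * real m) * b m)) {0..1}"
proof -
  have b': "summable (\<lambda>m. norm (b m))" using b by simp
  note S = integral_power_series[OF absolutely_integrable_powr[OF a] b']
  have "integral {0..1} (\<lambda>s. s powr (1 / a - 1) *\<^sub>R (\<Sum>m. s ^ m *\<^sub>R b m)) = (\<Sum>m. a / (1 + a * real m) * b m)"
    using sums_unique[OF S(2)] unfolding integral_unique[OF powr_moment[OF a]] by simp
  then have "((\<lambda>s. s powr (1 / a - 1) *\<^sub>R (\<Sum>m. s ^ m *\<^sub>R b m)) has_integral (\<Sum>m. a / (1 + a * real m) * b m)) {0..1}"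
    using integrable_integral[OF S(1)] by simp
  then show ?thesis
    by (rule has_integral_eq[rotated]) (simp add: g)
qed

lemma summable_powr_moment_mult:
  fixes a :: real
  assumes a: "a > 0" and b: "summable (\<lambda>m. \<bar>b m\<bar>)"
  shows "summable (\<lambda>m. \<bar>a / (1 + a * real m) * b m\<bar>)"
proof (rule summable_comparison_test'[OF summable_mult[OF b, of a], of 0])
  fix m
  have p: "1 + a * real m > 0" using a by (simp add: add_pos_nonneg)
  then have "a / (1 + a * real m) \<le> a / 1" using a by (intro divide_left_mono) auto
  then have "a / (1 + a * real m) * \<bar>b m\<bar> \<le> a / 1 * \<bar>b m\<bar>" by (rule mult_right_mono) simp
  then show "norm \<bar>a / (1 + a * real m) * b m\<bar> \<le> a * \<bar>b m\<bar>"
    using a p by (simp add: abs_mult)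
qed

lemma q_coeff_summable:
  assumes "\<bar>x\<bar> < 1" "\<delta> < 1"
  shows "summable (\<lambda>m. \<bar>q_coeff \<delta> m * (- x) ^ m\<bar>)"
proof -
  obtain r where r: "\<bar>x\<bar> < r" "r < 1" using assms dense by blast
  then have "summable (\<lambda>m. q_coeff \<delta> m * (- (- r)) ^ m)"
    using q_kernel_sums[of "- r" \<delta>] assms sums_summable by force
  then have "summable (\<lambda>m. norm (q_coeff \<delta> m * (- x) ^ m))"
    using powser_insidea[of "q_coeff \<delta>" r "- x"] r by simp
  then show ?thesis by simp
qed

text \<open>The integrations in s and w multiply the m-th coefficient by \<mu> / (1 + \<mu> m) and
  \<nu> / (1 + \<nu> m), and the prefactor of q cancels \<mu> \<nu>. The bound 4 is crude and serves
  as a majorant when x tends to 1: the numerator of the kernel is at most 2 in modulus, its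
  denominator at least 1/2, and the two normalised power weights have total mass 1.\<close>

lemma q_fun_series:
  assumes x: "0 \<le> x" "x < 1" and \<mu>: "\<mu> > 0" and \<nu>: "\<nu> > 0" and \<delta>: "0 \<le> \<delta>" "\<delta> \<le> 1/2"
  shows "(\<lambda>m. q_coeff \<delta> m / ((1 + \<mu> * real m) * (1 + \<nu> * real m)) * (- x) ^ m) sums q_fun \<mu> \<nu> \<delta> x"
    and "\<bar>q_fun \<mu> \<nu> \<delta> x\<bar> \<le> 4"
proof -
  define b where "b = (\<lambda>m. q_coeff \<delta> m * (- x) ^ m)"
  define B where "B = (\<lambda>m. \<mu> / (1 + \<mu> * real m) * b m)"
  define I where "I = (\<lambda>w. integral {0..1} (\<lambda>s. q_kernel \<delta> (s * w * x) * s powr (1 / \<mu> - 1)))"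
  have \<delta>1: "\<delta> < 1" using \<delta> by simp
  have sb: "summable (\<lambda>m. \<bar>b m\<bar>)" unfolding b_def using x \<delta>1 by (intro q_coeff_summable) auto
  have sB: "summable (\<lambda>m. \<bar>B m\<bar>)"
    unfolding B_def by (rule summable_powr_moment_mult[OF \<mu> sb])
  have lt: "\<bar>s * w * x\<bar> < 1" "0 \<le> s * w * x" if "0 \<le> s" "s \<le> 1" "0 \<le> w" "w \<le> 1" for s w
  proof -
    have "s * w * x \<le> 1 * 1 * x" using that x by (intro mult_mono) auto
    moreover show "0 \<le> s * w * x" using that x by simp
    ultimately show "\<bar>s * w * x\<bar> < 1" using x by simp
  qed
  have k: "q_kernel \<delta> (s * w * x) = (\<Sum>m. s ^ m * (w ^ m * b m))" if "0 \<le> s" "s \<le> 1" "0 \<le> w" "w \<le> 1" for s w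
  proof -
    have "q_coeff \<delta> m * (- (s * w * x)) ^ m = s ^ m * (w ^ m * b m)" for m
    proof -
      have "- (s * w * x) = s * w * (- x)" by simp
      then show ?thesis unfolding b_def by (simp only: power_mult_distrib mult_ac)
    qed
    then show ?thesis
      using sums_unique[OF q_kernel_sums[OF lt(1)[OF that] \<delta>1]] by simp
  qed
  have inner: "((\<lambda>s. q_kernel \<delta> (s * w * x) * s powr (1 / \<mu> - 1)) has_integral (\<Sum>m. w ^ m * B m)) {0..1}" if w: "0 \<le> w" "w \<le> 1" for w
  proof -
    have "((\<lambda>s. q_kernel \<delta> (s * w * x) * s powr (1 / \<mu> - 1)) has_integral (\<Sum>m. \<mu> / (1 + \<mu> * real m) * (w ^ m * b m))) {0..1}"
    proof (rule powr_integral_series[OF \<mu>])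
      have "\<bar>w ^ m * b m\<bar> \<le> \<bar>b m\<bar>" for m
        using w mult_right_mono[of "w ^ m" 1 "\<bar>b m\<bar>"] by (simp add: abs_mult power_le_one)
      then show "summable (\<lambda>m. \<bar>w ^ m * b m\<bar>)"
        by (intro summable_comparison_test'[OF sb, of 0]) auto
    qed (use k w in auto)
    then show ?thesis by (simp add: B_def mult_ac)
  qed
  have I: "I w = (\<Sum>m. w ^ m * B m)" if "0 \<le> w" "w \<le> 1" for w
    unfolding I_def by (rule integral_unique[OF inner[OF that]])
  have outer: "((\<lambda>w. I w * w powr (1 / \<nu> - 1)) has_integral (\<Sum>m. \<nu> / (1 + \<nu> * real m) * B m)) {0..1}"
    by (rule powr_integral_series[OF \<nu> sB I])
  have q: "q_fun \<mu> \<nu> \<delta> x = 1 / (\<mu> * \<nu>) * integral {0..1} (\<lambda>w. I w * w powr (1 / \<nu> - 1))"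
    unfolding q_fun_def I_def q_kernel_def integral_mult_left[symmetric] by (simp only: mult.assoc)
  have sB': "summable (\<lambda>m. \<nu> / (1 + \<nu> * real m) * B m)"
    by (rule summable_rabs_cancel[OF summable_powr_moment_mult[OF \<nu> sB]])
  have "(\<lambda>m. 1 / (\<mu> * \<nu>) * (\<nu> / (1 + \<nu> * real m) * B m)) sums q_fun \<mu> \<nu> \<delta> x"
    unfolding q integral_unique[OF outer] by (intro sums_mult summable_sums sB')
  moreover have "1 / (\<mu> * \<nu>) * (\<nu> / (1 + \<nu> * real m) * B m) = q_coeff \<delta> m / ((1 + \<mu> * real m) * (1 + \<nu> * real m)) * (- x) ^ m" for m
    using \<mu> \<nu> by (simp add: B_def b_def)
  ultimately show "(\<lambda>m. q_coeff \<delta> m / ((1 + \<mu> * real m) * (1 + \<nu> * real m)) * (- x) ^ m) sums q_fun \<mu> \<nu> \<delta> x"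
    by simp
  have kb: "\<bar>q_kernel \<delta> u\<bar> \<le> 4" if "0 \<le> u" "u < 1" for u
  proof -
    have "1/2 \<le> (1 - \<delta>) * 1" using \<delta> by simp
    also have "\<dots> \<le> (1 - \<delta>) * (1 + u) ^ 3" using that \<delta> by (intro mult_left_mono one_le_power) auto
    finally have d: "1/2 \<le> (1 - \<delta>) * (1 + u) ^ 3" .
    define e where "e = (1 + \<delta>) * u"
    have "e \<le> (1 + \<delta>) * 1" unfolding e_def using that \<delta> by (intro mult_left_mono) auto
    moreover have "0 \<le> e" using that \<delta> by (simp add: e_def)
    ultimately have n: "\<bar>(1 - \<delta>) - (1 + \<delta>) * u\<bar> \<le> 2"
      using \<delta> unfolding e_def[symmetric] by (simp add: abs_le_iff)
    have "\<bar>q_kernel \<delta> u\<bar> = \<bar>(1 - \<delta>) - (1 + \<delta>) * u\<bar> / ((1 - \<delta>) * (1 + u) ^ 3)"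
      using d unfolding q_kernel_def abs_divide by simp
    also have "\<dots> \<le> 2 / (1/2)" using n d by (intro frac_le) auto
    finally show ?thesis by simp
  qed
  have Ib: "\<bar>I w\<bar> \<le> 4 * \<mu>" if w: "0 \<le> w" "w \<le> 1" for w
  proof -
    have "norm (I w) \<le> integral {0..1} (\<lambda>s. 4 * s powr (1 / \<mu> - 1))"
      unfolding I_def
    proof (rule integral_norm_bound_integral)
      show "(\<lambda>s. 4 * s powr (1 / \<mu> - 1)) integrable_on {0..1}"
        using has_integral_integrable[OF powr_moment[OF \<mu>, of 0]] by (intro integrable_on_mult_right) simp
      show "norm (q_kernel \<delta> (s * w * x) * s powr (1 / \<mu> - 1)) \<le> 4 * s powr (1 / \<mu> - 1)" if "s \<in> {0..1}" for s
        unfolding norm_mult using kb[of "s * w * x"] lt[of s w] that w by (intro mult_mono) auto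
    qed (use has_integral_integrable[OF inner[OF w]] in auto)
    also have "\<dots> = 4 * \<mu>" using integral_unique[OF powr_moment[OF \<mu>, of 0]] by simp
    finally show ?thesis by simp
  qed
  have "norm (integral {0..1} (\<lambda>w. I w * w powr (1 / \<nu> - 1))) \<le> integral {0..1} (\<lambda>w. 4 * \<mu> * w powr (1 / \<nu> - 1))"
  proof (rule integral_norm_bound_integral)
    show "(\<lambda>s. 4 * \<mu> * s powr (1 / \<nu> - 1)) integrable_on {0..1}"
      using has_integral_integrable[OF powr_moment[OF \<nu>, of 0]] by (intro integrable_on_mult_right) simp
    show "norm (I w * w powr (1 / \<nu> - 1)) \<le> 4 * \<mu> * w powr (1 / \<nu> - 1)" if "w \<in> {0..1}" for w
      unfolding norm_mult using Ib[of w] that by (intro mult_mono) auto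
  qed (rule has_integral_integrable[OF outer])
  also have "\<dots> = 4 * \<mu> * \<nu>" using integral_unique[OF powr_moment[OF \<nu>, of 0]] by simp
  finally have "1 / (\<mu> * \<nu>) * \<bar>integral {0..1} (\<lambda>w. I w * w powr (1 / \<nu> - 1))\<bar> \<le> 1 / (\<mu> * \<nu>) * (4 * \<mu> * \<nu>)"
    using \<mu> \<nu> by (intro mult_left_mono) auto
  then show "\<bar>q_fun \<mu> \<nu> \<delta> x\<bar> \<le> 4"
    unfolding q using \<mu> \<nu> by (simp add: abs_mult)
qed

subsection \<open>The weight and its moments\<close>

text \<open>The real-variable data alone, independent of f. The bound \<mu> \<ge> 1 acts twice: it
  makes 1 - 1/\<mu> non-negative and t powr (1/\<mu> - 1) decreasing.\<close>

locale conv_weight =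
  fixes \<mu> \<nu> \<delta> :: real and lam :: "real \<Rightarrow> real"
  assumes \<mu>: "\<mu> \<ge> 1" and \<nu>: "\<nu> > 0" and \<delta>: "0 \<le> \<delta>" "\<delta> \<le> 1/2"
    and lam_nonneg: "\<And>t. t \<in> {0..1} \<Longrightarrow> lam t \<ge> 0" and lam_int: "lam integrable_on {0..1}"
    and lam_1: "integral {0..1} lam = 1"
    and \<Lambda>_pos: "\<And>t. 0 < t \<Longrightarrow> t < 1 \<Longrightarrow> Lambda_nu \<nu> lam t > 0"
    and \<Pi>_pos: "\<And>t. 0 < t \<Longrightarrow> t < 1 \<Longrightarrow> Pi_mu_nu \<mu> \<nu> lam t > 0"
    and decr: "\<And>s t. 0 < s \<Longrightarrow> s \<le> t \<Longrightarrow> t < 1 \<Longrightarrow>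
           (- t * deriv (Pi_mu_nu \<mu> \<nu> lam) t + (1 - 1 / \<mu>) * Pi_mu_nu \<mu> \<nu> lam t)
             / ((1 + t) * (1 - t) powr (1 + 2 * \<delta>))
           \<le> (- s * deriv (Pi_mu_nu \<mu> \<nu> lam) s + (1 - 1 / \<mu>) * Pi_mu_nu \<mu> \<nu> lam s)
             / ((1 + s) * (1 - s) powr (1 + 2 * \<delta>))"
begin

abbreviation "\<Lambda> \<equiv> Lambda_nu \<nu> lam"
abbreviation "\<Pi>\<^sub>0 \<equiv> Pi_mu_nu \<mu> \<nu> lam"

text \<open>The multiplier of \<open>V_op lam\<close> on the coefficient of z^(m+1); the shift by
  one reflects the division by t.\<close>

definition \<tau> :: "nat \<Rightarrow> real" where
  "\<tau> m = integral {0..1} (\<lambda>t. lam t * t ^ m)"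

text \<open>On (0, 1) one has -t \<open>\<Pi>\<^sub>0\<close>'(t) = \<open>\<Lambda>\<close> t * t
  powr (1/\<nu> - 1/\<mu>). Substituting this keeps \<open>deriv\<close> out of the weight, so
  moments can be computed without differentiating.\<close>

definition \<omega> :: "real \<Rightarrow> real" where
  "\<omega> t = (\<Lambda> t * t powr (1 / \<nu> - 1) + (1 - 1 / \<mu>) * (\<Pi>\<^sub>0 t * t powr (1 / \<mu> - 1))) / (\<mu> * \<nu>)"

lemma lam_abs: "lam absolutely_integrable_on {0..1}"
  using lam_int lam_nonneg by (intro nonnegative_absolutely_integrable_1) auto

lemma \<tau>_has: "((\<lambda>t. lam t * t ^ m) has_integral \<tau> m) {0..1}"
  unfolding \<tau>_def
  by (rule integrable_integral, rule set_lebesgue_integral_eq_integral(1),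
      rule absolutely_integrable_mult_continuous[OF lam_abs], rule continuous_on_power[OF continuous_on_id])

lemma \<tau>_0 [simp]: "\<tau> 0 = 1"
  using lam_1 by (simp add: \<tau>_def)

lemma \<Lambda>_eq: "\<Lambda> = (\<lambda>t. integral {t..1} (\<lambda>x. lam x * x powr (- 1 / \<nu>)))"
  by (rule ext) (simp add: Lambda_nu_def)

lemma \<Pi>_eq: "\<Pi>\<^sub>0 = (\<lambda>t. integral {t..1} (\<lambda>x. \<Lambda> x * x powr (1 / \<nu> - 1 - 1 / \<mu>)))"
  by (rule ext) (simp add: Pi_mu_nu_def)

lemma \<Lambda>_integrand_moment:
  "((\<lambda>x. (lam x * x powr (- 1 / \<nu>)) * x powr (1 / \<nu> + real m)) has_integral \<tau> m) {0..1}"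
proof (rule has_integral_spike_finite[OF _ _ \<tau>_has[of m], of "{0}"])
  fix x :: real assume "x \<in> {0..1} - {0}"
  then have "x powr (- 1 / \<nu>) * x powr (1 / \<nu> + real m) = x ^ m"
    by (simp add: powr_realpow flip: powr_add)
  then show "lam x * x powr (- 1 / \<nu>) * x powr (1 / \<nu> + real m) = lam x * x ^ m"
    by (simp add: mult.assoc)
qed simp

text \<open>The exponent is chosen so that the power 1/\<nu> + m in
  \<open>tail_integral_moment\<close> cancels the factor x powr (-1/\<nu>) and leaves a plain moment
  of \<lambda>. \<open>\<Pi>_moment\<close> repeats this one level up, with 1/\<mu> in place of
  1/\<nu>.\<close>

lemma \<Lambda>_moment: "((\<lambda>t. \<Lambda> t * t powr (1 / \<nu> - 1 + real m)) has_integral \<nu> * \<tau> m / (1 + \<nu> * real m)) {0..1}"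
proof -
  have p: "1 / \<nu> + real m > 0" using \<nu> by (simp add: add_pos_nonneg)
  have "((\<lambda>t. \<Lambda> t * t powr (1 / \<nu> + real m - 1)) has_integral \<tau> m / (1 / \<nu> + real m)) {0..1}"
    unfolding \<Lambda>_eq by (rule tail_integral_moment[OF p _ \<Lambda>_integrand_moment]) (use lam_nonneg in auto)
  moreover have "\<tau> m / (1 / \<nu> + real m) = \<nu> * \<tau> m / (1 + \<nu> * real m)"
  proof -
    have "1 / \<nu> + real m = (1 + \<nu> * real m) / \<nu>" using \<nu> by (simp add: add_divide_distrib)
    then show ?thesis by simp
  qed
  moreover have "1 / \<nu> + real m - 1 = 1 / \<nu> - 1 + real m" by simp
  ultimately show ?thesis by (simp only:)
qed

lemma \<Lambda>_nonneg: "0 < t \<Longrightarrow> t \<le> 1 \<Longrightarrow> \<Lambda> t \<ge> 0"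
  using \<Lambda>_pos[of t] by (cases "t = 1") (auto simp: Lambda_nu_def)

lemma \<Pi>_nonneg: "0 < t \<Longrightarrow> t \<le> 1 \<Longrightarrow> \<Pi>\<^sub>0 t \<ge> 0"
  using \<Pi>_pos[of t] by (cases "t = 1") (auto simp: Pi_mu_nu_def)

lemma \<Pi>_integrand_moment:
  "((\<lambda>x. (\<Lambda> x * x powr (1 / \<nu> - 1 - 1 / \<mu>)) * x powr (1 / \<mu> + real m)) has_integral \<nu> * \<tau> m / (1 + \<nu> * real m)) {0..1}"
proof -
  have "x powr (1 / \<nu> - 1 - 1 / \<mu>) * x powr (1 / \<mu> + real m) = x powr (1 / \<nu> - 1 + real m)" for x
    unfolding powr_add[symmetric] by (simp add: algebra_simps)
  then show ?thesis using \<Lambda>_moment[of m] by (simp only: mult.assoc)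
qed

lemma \<Pi>_moment:
  "((\<lambda>t. \<Pi>\<^sub>0 t * t powr (1 / \<mu> - 1 + real m)) has_integral \<mu> * (\<nu> * \<tau> m) / ((1 + \<mu> * real m) * (1 + \<nu> * real m))) {0..1}"
proof -
  have p: "1 / \<mu> + real m > 0" using \<mu> by (simp add: add_pos_nonneg)
  have "((\<lambda>t. \<Pi>\<^sub>0 t * t powr (1 / \<mu> + real m - 1)) has_integral \<nu> * \<tau> m / (1 + \<nu> * real m) / (1 / \<mu> + real m)) {0..1}"
    unfolding \<Pi>_eq by (rule tail_integral_moment[OF p _ \<Pi>_integrand_moment]) (use \<Lambda>_nonneg in auto)
  moreover have "\<nu> * \<tau> m / (1 + \<nu> * real m) / (1 / \<mu> + real m) = \<mu> * (\<nu> * \<tau> m) / ((1 + \<mu> * real m) * (1 + \<nu> * real m))"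
  proof -
    have e: "1 / \<mu> + real m = (1 + \<mu> * real m) / \<mu>" using \<mu> by (simp add: add_divide_distrib)
    have "x / y / (z / \<mu>) = \<mu> * x / (z * y)" for x y z :: real by (simp add: mult.commute)
    then show ?thesis unfolding e .
  qed
  moreover have "1 / \<mu> + real m - 1 = 1 / \<mu> - 1 + real m" by simp
  ultimately show ?thesis by (simp only:)
qed

text \<open>Put over a common denominator, the two summands give 1 + \<mu> m + \<mu> - 1 = \<mu> (m
  + 1). This is where the coefficient 1 - 1/\<mu> produces the factor m + 1 required by F'.\<close>

lemma \<omega>_moment:
  "((\<lambda>t. \<omega> t * t ^ m) has_integral real (Suc m) * \<tau> m / ((1 + \<mu> * real m) * (1 + \<nu> * real m))) {0..1}"
proof -
  define a where "a = 1 + \<mu> * real m"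
  define b where "b = 1 + \<nu> * real m"
  have pos: "a > 0" "b > 0" using \<mu> \<nu> by (auto simp: a_def b_def add_pos_nonneg)
  have "((\<lambda>t. (\<Lambda> t * t powr (1 / \<nu> - 1 + real m) + (1 - 1 / \<mu>) * (\<Pi>\<^sub>0 t * t powr (1 / \<mu> - 1 + real m))) / (\<mu> * \<nu>))
      has_integral (\<nu> * \<tau> m / b + (1 - 1 / \<mu>) * (\<mu> * (\<nu> * \<tau> m) / (a * b))) / (\<mu> * \<nu>)) {0..1}"
    unfolding a_def b_def by (intro has_integral_divide has_integral_add has_integral_mult_right \<Lambda>_moment \<Pi>_moment)
  also have "(\<nu> * \<tau> m / b + (1 - 1 / \<mu>) * (\<mu> * (\<nu> * \<tau> m) / (a * b))) / (\<mu> * \<nu>) = real (Suc m) * \<tau> m / (a * b)"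
  proof -
    have "(1 - 1 / \<mu>) * \<mu> = \<mu> - 1" using \<mu> by (simp add: field_simps)
    then have "\<nu> * \<tau> m / b + (1 - 1 / \<mu>) * (\<mu> * (\<nu> * \<tau> m) / (a * b)) = \<nu> * \<tau> m / b + (\<mu> - 1) * (\<nu> * \<tau> m) / (a * b)"
      by (simp flip: mult.assoc)
    also have "\<dots> = (a + \<mu> - 1) * (\<nu> * \<tau> m) / (a * b)"
      using pos by (simp add: field_simps)
    also have "a + \<mu> - 1 = \<mu> * real (Suc m)" by (simp add: a_def algebra_simps)
    finally show ?thesis using \<mu> \<nu> by simp
  qed
  finally have *: "((\<lambda>t. (\<Lambda> t * t powr (1 / \<nu> - 1 + real m) + (1 - 1 / \<mu>) * (\<Pi>\<^sub>0 t * t powr (1 / \<mu> - 1 + real m))) / (\<mu> * \<nu>))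
      has_integral real (Suc m) * \<tau> m / (a * b)) {0..1}" .
  show ?thesis
    unfolding a_def[symmetric] b_def[symmetric]
  proof (rule has_integral_spike_finite[OF _ _ *, of "{0}"])
    fix t :: real assume "t \<in> {0..1} - {0}"
    then have "t powr (x + real m) = t powr x * t ^ m" for x
      by (simp add: powr_add powr_realpow)
    then show "\<omega> t * t ^ m = (\<Lambda> t * t powr (1 / \<nu> - 1 + real m) + (1 - 1 / \<mu>) * (\<Pi>\<^sub>0 t * t powr (1 / \<mu> - 1 + real m))) / (\<mu> * \<nu>)"
      unfolding \<omega>_def by (simp only: times_divide_eq_left distrib_right mult.assoc)
  qed simp
qed

lemma \<omega>_nonneg: "t \<in> {0..1} \<Longrightarrow> \<omega> t \<ge> 0"
  using \<Lambda>_nonneg[of t] \<Pi>_nonneg[of t] \<mu> \<nu>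
  by (cases "t = 0") (auto simp: \<omega>_def intro!: divide_nonneg_nonneg add_nonneg_nonneg mult_nonneg_nonneg)

lemma \<omega>_half_pos: "\<omega> (1/2) > 0"
  unfolding \<omega>_def using \<Lambda>_pos[of "1/2"] \<Pi>_pos[of "1/2"] \<mu> \<nu>
  by (intro divide_pos_pos add_pos_nonneg mult_pos_pos mult_nonneg_nonneg) auto

lemma \<omega>_abs: "\<omega> absolutely_integrable_on {0..1}"
  using \<omega>_moment[of 0] \<omega>_nonneg by (intro nonnegative_absolutely_integrable_1) (auto simp: integrable_on_def)

lemma deriv_\<Pi>:
  assumes t: "0 < t" "t < 1"
  shows "deriv \<Pi>\<^sub>0 t = - (\<Lambda> t * t powr (1 / \<nu> - 1 - 1 / \<mu>))"
proof -
  \<comment> \<open>Any point between 0 and t would do; it keeps the negative power of x in the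
    integrand of \<open>\<Lambda>\<close> away from 0.\<close>
  define a where "a = t / 2"
  have a: "0 < a" "a < t" using t by (auto simp: a_def)
  have "(\<lambda>x. lam x * x powr (- 1 / \<nu>)) integrable_on {a..1}"
    by (rule tail_integral_integrable[OF _ has_integral_integrable[OF \<Lambda>_integrand_moment[of 0]] a(1)])
      (use lam_nonneg in auto)
  then have "continuous_on {a..1} \<Lambda>"
    unfolding \<Lambda>_eq by (rule indefinite_integral_continuous_1')
  then have "continuous_on {a..1} (\<lambda>x. \<Lambda> x * x powr (1 / \<nu> - 1 - 1 / \<mu>))"
    by (intro continuous_on_mult continuous_on_powr continuous_on_id continuous_on_const) (use a in auto)
  then have "(\<Pi>\<^sub>0 has_real_derivative - (\<Lambda> t * t powr (1 / \<nu> - 1 - 1 / \<mu>))) (at t within {a..1})"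
    unfolding \<Pi>_eq using a t by (intro integral_has_real_derivative') auto
  then have "(\<Pi>\<^sub>0 has_real_derivative - (\<Lambda> t * t powr (1 / \<nu> - 1 - 1 / \<mu>))) (at t)"
    unfolding at_within_Icc_at[OF a(2) t(2)] .
  then show ?thesis by (rule DERIV_imp_deriv)
qed

text \<open>Up to 1 / (\<mu> \<nu>), \<omega> is the numerator \<Phi> of the monotonicity assumption
  times t powr (1/\<mu> - 1). Both \<Phi> over the denominator and this power are non-negative and
  decreasing.\<close>

lemma \<omega>_decreasing:
  assumes st: "0 < s" "s \<le> t" "t < 1"
  shows "\<omega> t / ((1 + t) * (1 - t) powr (1 + 2 * \<delta>)) \<le> \<omega> s / ((1 + s) * (1 - s) powr (1 + 2 * \<delta>))"
proof -
  define \<Phi> where "\<Phi> = (\<lambda>t. - t * deriv \<Pi>\<^sub>0 t + (1 - 1 / \<mu>) * \<Pi>\<^sub>0 t)"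
  have \<omega>: "\<omega> x = \<Phi> x * x powr (1 / \<mu> - 1) / (\<mu> * \<nu>)" "\<Phi> x \<ge> 0" if x: "0 < x" "x < 1" for x
  proof -
    have "x * x powr (1 / \<nu> - 1 - 1 / \<mu>) = x powr (1 / \<nu> - 1 / \<mu>)"
      using x powr_mult_base[of x "1 / \<nu> - 1 - 1 / \<mu>"] by simp
    then have *: "\<Phi> x = \<Lambda> x * x powr (1 / \<nu> - 1 / \<mu>) + (1 - 1 / \<mu>) * \<Pi>\<^sub>0 x"
      unfolding \<Phi>_def deriv_\<Pi>[OF x] by (simp add: mult_ac)
    then show "\<Phi> x \<ge> 0" using \<Lambda>_pos[OF x] \<Pi>_pos[OF x] \<mu> by (auto intro!: add_nonneg_nonneg)
    have "x powr (1 / \<nu> - 1 / \<mu>) * x powr (1 / \<mu> - 1) = x powr (1 / \<nu> - 1)"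
      by (simp flip: powr_add)
    then show "\<omega> x = \<Phi> x * x powr (1 / \<mu> - 1) / (\<mu> * \<nu>)"
      unfolding * \<omega>_def by (simp add: distrib_right mult.assoc)
  qed
  have dec: "\<Phi> t / ((1 + t) * (1 - t) powr (1 + 2 * \<delta>)) \<le> \<Phi> s / ((1 + s) * (1 - s) powr (1 + 2 * \<delta>))"
    unfolding \<Phi>_def by (rule decr[OF st])
  have "t powr (1 / \<mu> - 1) \<le> s powr (1 / \<mu> - 1)"
    using st \<mu> by (intro powr_mono2') auto
  then have "\<Phi> t / ((1 + t) * (1 - t) powr (1 + 2 * \<delta>)) * (t powr (1 / \<mu> - 1) / (\<mu> * \<nu>))
      \<le> \<Phi> s / ((1 + s) * (1 - s) powr (1 + 2 * \<delta>)) * (s powr (1 / \<mu> - 1) / (\<mu> * \<nu>))"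
    using dec \<omega>(2)[of s] st \<mu> \<nu> by (intro mult_mono divide_right_mono) auto
  moreover have e: "a * b / c / d = a / d * (b / c)" for a b c d :: real by simp
  have "\<omega> t = \<Phi> t * t powr (1 / \<mu> - 1) / (\<mu> * \<nu>)" "\<omega> s = \<Phi> s * s powr (1 / \<mu> - 1) / (\<mu> * \<nu>)"
    using st by (auto intro!: \<omega>(1))
  ultimately show ?thesis by (simp only: e)
qed

text \<open>The value at -|z| for \<epsilon> = 1 is the intermediate term: it exceeds the value at
  -1 strictly and is at most the real part on the right.\<close>

lemma Re_\<omega>_kernel_gt:
  assumes z: "norm z < 1" and \<epsilon>: "norm \<epsilon> \<le> 1"
  shows "integral {0..1} (\<lambda>t. \<omega> t * conv_kernel (1 / (1 - \<delta>)) (- t))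
    < Re (integral {0..1} (\<lambda>t. \<omega> t *\<^sub>R conv_kernel ((1 + \<epsilon>) / of_real (2 * (1 - \<delta>))) (of_real t * z)))"
  using weighted_kernel_integral_strict[OF \<omega>_abs \<omega>_nonneg \<omega>_decreasing \<omega>_half_pos \<delta> norm_ge_zero z]
    weighted_kernel_integral_ge[OF \<omega>_abs \<omega>_nonneg \<omega>_decreasing \<delta> z \<epsilon>] by linarith

lemma \<omega>_kernel_sums:
  fixes c w :: complex
  assumes w: "norm w < 1"
  shows "(\<lambda>m. (1 + c * of_nat m) * of_real (integral {0..1} (\<lambda>t. \<omega> t * t ^ m)) * w ^ m) sums
    integral {0..1} (\<lambda>t. \<omega> t *\<^sub>R conv_kernel c (of_real t * w))"
proof -
  define b where "b = (\<lambda>m. (1 + c * of_nat m) * w ^ m)"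
  have b: "summable (\<lambda>m. norm (b m))"
    unfolding b_def by (rule summable_norm_power_series[OF conv_kernel_sums w])
  have eq: "(\<Sum>m. t ^ m *\<^sub>R b m) = conv_kernel c (of_real t * w)" if "t \<in> {0..1}" for t
  proof -
    have "norm (of_real t * w) < 1"
      using that mult_right_mono[of t 1 "norm w"] w by (simp add: norm_mult)
    from sums_unique[OF conv_kernel_sums[OF this, of c]] show ?thesis
      by (simp add: b_def scaleR_conv_of_real power_mult_distrib mult_ac)
  qed
  have "integral {0..1} (\<lambda>t. \<omega> t *\<^sub>R (\<Sum>m. t ^ m *\<^sub>R b m)) = integral {0..1} (\<lambda>t. \<omega> t *\<^sub>R conv_kernel c (of_real t * w))"
    by (rule integral_cong) (simp add: eq)
  then show ?thesis
    using integral_power_series(2)[OF \<omega>_abs b] by (simp add: b_def scaleR_conv_of_real mult_ac)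
qed

end

subsection \<open>Convexity of the transform\<close>

text \<open>The series for w G'' is indexed so that its n-th term carries w^n, with a vanishing term
  at n = 0; combinations with G' can then be added term by term.\<close>

lemma power_series_derivs:
  fixes c :: "nat \<Rightarrow> complex"
  assumes G: "\<And>w. norm w < 1 \<Longrightarrow> (\<lambda>n. c n * w ^ n) sums G w"
  shows "G holomorphic_on ball 0 1"
    and "norm w < 1 \<Longrightarrow> (\<lambda>n. of_nat (Suc n) * c (Suc n) * w ^ n) sums deriv G w"
    and "norm w < 1 \<Longrightarrow> (\<lambda>n. of_nat n * of_nat (Suc n) * c (Suc n) * w ^ n) sums (w * deriv (deriv G) w)"
proof -
  have step: "H holomorphic_on ball 0 1" "norm w < 1 \<Longrightarrow> (\<lambda>n. diffs d n * w ^ n) sums deriv H w"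
    if H: "\<And>w. norm w < 1 \<Longrightarrow> (\<lambda>n. d n * w ^ n) sums H w" for d :: "nat \<Rightarrow> complex" and H w
  proof -
    show hol: "H holomorphic_on ball 0 1"
      by (rule power_series_holomorphic) (use H in auto)
    assume w: "norm w < 1"
    then have "(H has_field_derivative deriv H w) (at w)"
      by (intro holomorphic_derivI[OF hol]) auto
    show "(\<lambda>n. diffs d n * w ^ n) sums deriv H w"
      by (rule termdiffs_sums_strong[OF H \<open>(H has_field_derivative deriv H w) (at w)\<close> w])
  qed
  show "G holomorphic_on ball 0 1" by (rule step(1)[OF G])
  show "(\<lambda>n. of_nat (Suc n) * c (Suc n) * w ^ n) sums deriv G w" if "norm w < 1"
    using step(2)[OF G that] by (simp only: diffs_def)
  show "(\<lambda>n. of_nat n * of_nat (Suc n) * c (Suc n) * w ^ n) sums (w * deriv (deriv G) w)" if "norm w < 1"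
  proof -
    have "(\<lambda>n. w * (diffs (diffs c) n * w ^ n)) sums (w * deriv (deriv G) w)"
      by (intro sums_mult step(2)[OF step(2)[OF G]] that)
    also have "(\<lambda>n. w * (diffs (diffs c) n * w ^ n)) = (\<lambda>n. of_nat (Suc n) * of_nat (Suc (Suc n)) * c (Suc (Suc n)) * w ^ Suc n)"
      by (rule ext) (simp only: diffs_def power_Suc mult_ac)
    finally show ?thesis
      using sums_Suc[of "\<lambda>n. of_nat n * of_nat (Suc n) * c (Suc n) * w ^ n"] by simp
  qed
qed

context conv_weight
begin

text \<open>Both integrals are the same power series in -r: the factor (m + 1) / ((1 + \<mu> m)(1 +
  \<nu> m)) belongs to the coefficients of q on one side and to the moments of
  \<open>\<omega>\<close> on the other.\<close>

lemma q_integral_scaled: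
  assumes r: "0 \<le> r" "r < 1"
  shows "(\<lambda>t. lam t * q_fun \<mu> \<nu> \<delta> (r * t)) integrable_on {0..1}"
    and "integral {0..1} (\<lambda>t. lam t * q_fun \<mu> \<nu> \<delta> (r * t))
      = integral {0..1} (\<lambda>t. \<omega> t * conv_kernel (1 / (1 - \<delta>)) (- (r * t)))"
proof -
  define N where "N = (\<lambda>m. (1 + \<mu> * real m) * (1 + \<nu> * real m))"
  define b where "b = (\<lambda>m. q_coeff \<delta> m / N m * (- r) ^ m)"
  define b' where "b' = (\<lambda>m. (1 + 1 / (1 - \<delta>) * real m) * (- r) ^ m)"
  have \<delta>1: "\<delta> < 1" using \<delta> by simp
  have \<mu>0: "\<mu> > 0" using \<mu> by simp
  have N1: "1 \<le> N m" for m
  proof -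
    have "1 * 1 \<le> N m" unfolding N_def using \<mu> \<nu> by (intro mult_mono) auto
    then show ?thesis by simp
  qed
  have rt: "0 \<le> r * t" "r * t < 1" if "t \<in> {0..1}" for t
  proof -
    have "r * t \<le> r * 1" using that r by (intro mult_left_mono) auto
    then show "r * t < 1" using r by linarith
    show "0 \<le> r * t" using that r by simp
  qed
  have b: "summable (\<lambda>m. norm (b m))"
  proof (rule summable_comparison_test'[OF q_coeff_summable[of r \<delta>], of 0])
    fix m
    have "\<bar>q_coeff \<delta> m * (- r) ^ m\<bar> / N m \<le> \<bar>q_coeff \<delta> m * (- r) ^ m\<bar> / 1"
      using N1[of m] by (intro divide_left_mono) auto
    then show "norm (norm (b m)) \<le> \<bar>q_coeff \<delta> m * (- r) ^ m\<bar>"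
      using N1[of m] by (simp add: b_def abs_mult)
  qed (use r \<delta>1 in auto)
  have b': "summable (\<lambda>m. norm (b' m))"
  proof (rule summable_comparison_test'[OF q_coeff_summable[of r \<delta>], of 0])
    fix m
    have "1 * \<bar>b' m\<bar> \<le> real (Suc m) * \<bar>b' m\<bar>" by (intro mult_right_mono) auto
    then show "norm (norm (b' m)) \<le> \<bar>q_coeff \<delta> m * (- r) ^ m\<bar>"
      by (simp add: b'_def q_coeff_def abs_mult mult.assoc)
  qed (use r \<delta>1 in auto)
  have "(- (r * t)) ^ m = t ^ m * (- r) ^ m" for t m
    by (metis minus_mult_left mult.commute power_mult_distrib)
  note pw = this
  have e1: "(\<Sum>m. t ^ m *\<^sub>R b m) = q_fun \<mu> \<nu> \<delta> (r * t)" if "t \<in> {0..1}" for t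
    using sums_unique[OF q_fun_series(1)[OF rt[OF that] \<mu>0 \<nu> \<delta>]]
    unfolding pw by (simp add: b_def N_def mult_ac)
  have e2: "(\<Sum>m. t ^ m *\<^sub>R b' m) = conv_kernel (1 / (1 - \<delta>)) (- (r * t))" if "t \<in> {0..1}" for t
  proof -
    have "norm (- (r * t)) < 1" using rt[OF that] by simp
    from sums_unique[OF conv_kernel_sums[OF this, of "1 / (1 - \<delta>)"]] show ?thesis
      unfolding pw by (simp add: b'_def mult_ac)
  qed
  note P = integral_power_series[OF lam_abs b] and P' = integral_power_series[OF \<omega>_abs b']
  show "(\<lambda>t. lam t * q_fun \<mu> \<nu> \<delta> (r * t)) integrable_on {0..1}"
    by (rule integrable_eq[OF P(1)]) (simp add: e1[simplified])
  have "integral {0..1} (\<lambda>t. lam t * t ^ m) *\<^sub>R b m = integral {0..1} (\<lambda>t. \<omega> t * t ^ m) *\<^sub>R b' m" for m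
    unfolding integral_unique[OF \<tau>_has] integral_unique[OF \<omega>_moment]
    by (simp add: b_def b'_def q_coeff_def N_def mult_ac)
  then have "integral {0..1} (\<lambda>t. lam t *\<^sub>R (\<Sum>m. t ^ m *\<^sub>R b m)) = integral {0..1} (\<lambda>t. \<omega> t *\<^sub>R (\<Sum>m. t ^ m *\<^sub>R b' m))"
    using sums_unique2[OF P(2)] P'(2) by simp
  moreover have "integral {0..1} (\<lambda>t. lam t *\<^sub>R (\<Sum>m. t ^ m *\<^sub>R b m)) = integral {0..1} (\<lambda>t. lam t * q_fun \<mu> \<nu> \<delta> (r * t))"
    by (rule integral_cong) (simp add: e1[simplified])
  moreover have "integral {0..1} (\<lambda>t. \<omega> t *\<^sub>R (\<Sum>m. t ^ m *\<^sub>R b' m)) = integral {0..1} (\<lambda>t. \<omega> t * conv_kernel (1 / (1 - \<delta>)) (- (r * t)))"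
    by (rule integral_cong) (simp add: e2[simplified])
  ultimately show "integral {0..1} (\<lambda>t. lam t * q_fun \<mu> \<nu> \<delta> (r * t))
      = integral {0..1} (\<lambda>t. \<omega> t * conv_kernel (1 / (1 - \<delta>)) (- (r * t)))" by simp
qed

lemma q_fun_tendsto:
  assumes t: "0 \<le> t" "t < 1" and r: "r \<longlonglongrightarrow> 1" "\<And>n. 0 \<le> r n \<and> r n < (1::real)"
  shows "(\<lambda>n. q_fun \<mu> \<nu> \<delta> (r n * t)) \<longlonglongrightarrow> q_fun \<mu> \<nu> \<delta> t"
proof -
  define d where "d = (\<lambda>m. q_coeff \<delta> m / ((1 + \<mu> * real m) * (1 + \<nu> * real m)))"
  have \<mu>0: "\<mu> > 0" using \<mu> by simp
  have q: "q_fun \<mu> \<nu> \<delta> x = (\<Sum>m. d m * (- x) ^ m)" "summable (\<lambda>m. d m * (- x) ^ m)" if "0 \<le> x" "x < 1" for x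
    using q_fun_series(1)[OF that \<mu>0 \<nu> \<delta>] unfolding d_def by (rule sums_unique, rule sums_summable)
  obtain k where k: "t < k" "k < 1" using t dense by blast
  have "isCont (\<lambda>x. \<Sum>m. d m * x ^ m) (- t)"
    by (rule isCont_powser[OF q(2)[of k]]) (use k t in auto)
  moreover have "(\<lambda>n. - (r n * t)) \<longlonglongrightarrow> - t"
    using tendsto_minus[OF tendsto_mult_right[OF r(1), of t]] by simp
  ultimately have "(\<lambda>n. \<Sum>m. d m * (- (r n * t)) ^ m) \<longlonglongrightarrow> (\<Sum>m. d m * (- t) ^ m)"
    by (rule isCont_tendsto_compose)
  moreover have "0 \<le> r n * t" "r n * t < 1" for n
    using r(2)[of n] t mult_le_one[of "r n" t] mult_strict_mono'[of "r n" 1 t 1] by auto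
  ultimately show ?thesis using q(1) t by simp
qed

text \<open>The power series of \<open>q\<close> need not converge at \<open>1\<close>, hence the Abel limit \<open>r \<longrightarrow> 1\<close> of the scaled identity.\<close>

lemma q_integral:
  "integral {0..1} (\<lambda>t. lam t * q_fun \<mu> \<nu> \<delta> t) = integral {0..1} (\<lambda>t. \<omega> t * conv_kernel (1 / (1 - \<delta>)) (- t))"
proof -
  define r where "r = (\<lambda>n. real n / real (Suc n))"
  have r: "r \<longlonglongrightarrow> 1" "\<And>n. 0 \<le> r n \<and> r n < 1"
    using LIMSEQ_n_over_Suc_n by (auto simp: r_def)
  have \<mu>0: "\<mu> > 0" using \<mu> by simp
  define A where "A = (\<lambda>n. integral {0..1} (\<lambda>t. lam t * q_fun \<mu> \<nu> \<delta> (r n * t)))"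
  have rt: "0 \<le> r n * t" "r n * t < 1" if "t \<in> {0..1}" for n t
  proof -
    have "r n * t \<le> r n * 1" using that r(2)[of n] by (intro mult_left_mono) auto
    then show "r n * t < 1" using r(2)[of n] by linarith
    show "0 \<le> r n * t" using that r(2)[of n] by simp
  qed
  have r01: "r n * t \<in> {0..1}" if "t \<in> {0..1}" for n t
    using rt[OF that, of n] by simp
  have "A \<longlonglongrightarrow> integral {0..1} (\<lambda>t. lam t * q_fun \<mu> \<nu> \<delta> t)"
  proof -
    \<comment> \<open>The limit of q at r t is available only for t < 1, so the single point t = 1
      is removed from the integrals.\<close>
    define f where "f = (\<lambda>n t. if t = 1 then 0 else lam t * q_fun \<mu> \<nu> \<delta> (r n * t))"
    define g where "g = (\<lambda>t. if t = 1 then 0 else lam t * q_fun \<mu> \<nu> \<delta> t)"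
    have "f n integrable_on {0..1}" for n
      by (rule integrable_spike_finite[of "{1}", OF _ _ q_integral_scaled(1)[of "r n"]]) (use r(2) in \<open>auto simp: f_def\<close>)
    moreover have "(\<lambda>t. lam t * 4) integrable_on {0..1}" using lam_int by (rule integrable_on_mult_left)
    moreover have "norm (f n t) \<le> lam t * 4" if "t \<in> {0..1}" for n t
      using mult_left_mono[OF q_fun_series(2)[OF rt[OF that, of n] \<mu>0 \<nu> \<delta>] lam_nonneg[OF that]] lam_nonneg[OF that]
      by (auto simp: f_def abs_mult)
    moreover have "(\<lambda>n. f n t) \<longlonglongrightarrow> g t" if "t \<in> {0..1}" for t
    proof (cases "t = 1")
      case False
      then have "(\<lambda>n. q_fun \<mu> \<nu> \<delta> (r n * t)) \<longlonglongrightarrow> q_fun \<mu> \<nu> \<delta> t"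
        using that by (intro q_fun_tendsto r) auto
      from tendsto_mult_left[OF this, of "lam t"] show ?thesis using False by (simp add: f_def g_def)
    qed (simp add: f_def g_def)
    ultimately have "(\<lambda>n. integral {0..1} (f n)) \<longlonglongrightarrow> integral {0..1} g"
      by (rule dominated_convergence(2))
    moreover have "integral {0..1} (f n) = A n" for n
      unfolding A_def by (rule integral_spike[of "{1}"]) (auto simp: f_def)
    moreover have "integral {0..1} g = integral {0..1} (\<lambda>t. lam t * q_fun \<mu> \<nu> \<delta> t)"
      by (rule integral_spike[of "{1}"]) (auto simp: g_def)
    ultimately show ?thesis by simp
  qed
  moreover have "A \<longlonglongrightarrow> integral {0..1} (\<lambda>t. \<omega> t * conv_kernel (1 / (1 - \<delta>)) (- t))"
  proof -
    define g where "g = (\<lambda>t::real. conv_kernel (1 / (1 - \<delta>)) (- t))"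
    have gc: "continuous_on {0..1} g"
      unfolding g_def conv_kernel_def by (intro continuous_intros) force+
    obtain B where B: "\<forall>x\<in>g ` {0..1}. norm x \<le> B"
      using compact_imp_bounded[OF compact_continuous_image[OF gc compact_Icc]] unfolding bounded_iff by blast
    have "(\<lambda>t. \<omega> t * g (r n * t)) integrable_on {0..1}" for n
    proof -
      have "continuous_on {0..1} (\<lambda>t. g (r n * t))"
        by (rule continuous_on_compose2[OF gc continuous_on_mult[OF continuous_on_const continuous_on_id]])
          (use r01 in blast)
      then show ?thesis
        by (rule set_lebesgue_integral_eq_integral(1)[OF absolutely_integrable_mult_continuous[OF \<omega>_abs]])
    qed
    moreover have "(\<lambda>t. \<omega> t * B) integrable_on {0..1}"
      using set_lebesgue_integral_eq_integral(1)[OF \<omega>_abs] by (rule integrable_on_mult_left)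
    moreover have "norm (\<omega> t * g (r n * t)) \<le> \<omega> t * B" if "t \<in> {0..1}" for n t
    proof -
      have "norm (g (r n * t)) \<le> B" using B r01[OF that, of n] by blast
      then show ?thesis using \<omega>_nonneg[OF that] by (simp add: abs_mult mult_left_mono)
    qed
    moreover have "(\<lambda>n. \<omega> t * g (r n * t)) \<longlonglongrightarrow> \<omega> t * g t" if "t \<in> {0..1}" for t
    proof -
      have "(\<lambda>n. r n * t) \<longlonglongrightarrow> t" using tendsto_mult_right[OF r(1), of t] by simp
      then have "(\<lambda>n. g (r n * t)) \<longlonglongrightarrow> g t"
        by (rule continuous_on_tendsto_compose[OF gc]) (use that r01 in auto)
      then show ?thesis by (rule tendsto_mult_left)
    qed
    ultimately have "(\<lambda>n. integral {0..1} (\<lambda>t. \<omega> t * g (r n * t))) \<longlonglongrightarrow> integral {0..1} (\<lambda>t. \<omega> t * g t)"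
      by (rule dominated_convergence(2))
    moreover have "integral {0..1} (\<lambda>t. \<omega> t * g (r n * t)) = A n" for n
      unfolding A_def g_def using q_integral_scaled(2)[of "r n"] r(2) by simp
    ultimately show ?thesis by (simp add: g_def)
  qed
  ultimately show ?thesis by (rule LIMSEQ_unique)
qed

lemma V_op_sums:
  fixes a :: "nat \<Rightarrow> complex"
  assumes f: "\<And>w. norm w < 1 \<Longrightarrow> (\<lambda>n. a n * w ^ n) sums f w" and a0: "a 0 = 0" and z: "norm z < 1"
  shows "(\<lambda>n. (case n of 0 \<Rightarrow> 0 | Suc m \<Rightarrow> of_real (\<tau> m) * a (Suc m)) * z ^ n) sums V_op lam f z"
proof -
  define b where "b = (\<lambda>m. a (Suc m) * z ^ Suc m)"
  have b: "summable (\<lambda>m. norm (b m))"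
    unfolding b_def using summable_norm_power_series[OF f z] by (subst summable_Suc_iff[of "\<lambda>m. norm (a m * z ^ m)"])
  have e: "(\<Sum>m. t ^ m *\<^sub>R b m) = f (of_real t * z) / of_real t" if t: "t \<in> {0..1} - {0}" for t
  proof -
    have "norm (of_real t * z) < 1"
      using that mult_right_mono[of t 1 "norm z"] z by (simp add: norm_mult)
    from f[OF this] have "(\<lambda>n. a (Suc n) * (of_real t * z) ^ Suc n) sums f (of_real t * z)"
      using sums_Suc_iff[of "\<lambda>n. a n * (of_real t * z) ^ n"] a0 by simp
    from sums_divide[OF this, of "of_real t"]
    have "(\<lambda>n. a (Suc n) * (of_real t * z) ^ Suc n / of_real t) sums (f (of_real t * z) / of_real t)" .
    also have "(\<lambda>n. a (Suc n) * (of_real t * z) ^ Suc n / of_real t) = (\<lambda>n. t ^ n *\<^sub>R b n)"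
      using t by (intro ext) (simp add: b_def scaleR_conv_of_real power_mult_distrib)
    finally show ?thesis by (rule sums_unique[symmetric])
  qed
  have "integral {0..1} (\<lambda>t. lam t *\<^sub>R (\<Sum>m. t ^ m *\<^sub>R b m)) = V_op lam f z"
    unfolding V_op_def
  proof (rule integral_spike[of "{0}"])
    show "of_real (lam t) * f (of_real t * z) / of_real t = lam t *\<^sub>R (\<Sum>m. t ^ m *\<^sub>R b m)" if "t \<in> {0..1} - {0}" for t
      unfolding e[OF that] by (simp add: scaleR_conv_of_real)
  qed simp
  then have "(\<lambda>m. \<tau> m *\<^sub>R b m) sums V_op lam f z"
    using integral_power_series(2)[OF lam_abs b] unfolding \<tau>_def by simp
  then have "(\<lambda>n. (case Suc n of 0 \<Rightarrow> 0 | Suc m \<Rightarrow> of_real (\<tau> m) * a (Suc m)) * z ^ Suc n) sums V_op lam f z"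
    by (simp add: b_def scaleR_conv_of_real mult.assoc)
  from sums_Suc[OF this] show ?thesis by simp
qed

text \<open>If the combination vanished, the Hadamard product of e^(i\<phi>)(H - \<beta>) with the
  kernel transform would equal -\<beta> e^(i\<phi>) at z. Then \<open>Re_hadamard_product_gt\<close>
  would give (1 - 2 \<beta>) cos \<phi> > (1 - 2 \<beta>) cos \<phi>, because the condition on
  \<beta> says c0 (1 - \<beta>) = 1/2 - \<beta>.\<close>

lemma V_op_combination_nonzero:
  fixes a :: "nat \<Rightarrow> complex" and \<beta> \<phi> :: real
  assumes f: "\<And>w. norm w < 1 \<Longrightarrow> (\<lambda>n. a n * w ^ n) sums f w" and a0: "a 0 = 0" and a1: "a 1 = 1"
    and H: "\<And>w. norm w < 1 \<Longrightarrow> (\<lambda>n. of_real ((1 + \<mu> * real n) * (1 + \<nu> * real n)) * a (Suc n) * w ^ n) sums H w"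
    and Hpos: "\<And>w. norm w < 1 \<Longrightarrow> Re (cis \<phi> * (H w - of_real \<beta>)) > 0"
    and \<beta>: "\<beta> < 1" "(\<beta> - 1/2) / (1 - \<beta>) = - integral {0..1} (\<lambda>t. lam t * q_fun \<mu> \<nu> \<delta> t)"
    and z: "norm z < 1" and \<epsilon>: "norm \<epsilon> \<le> 1" and c: "c = (1 + \<epsilon>) / of_real (2 * (1 - \<delta>))"
  shows "deriv (V_op lam f) z + c * (z * deriv (deriv (V_op lam f)) z) \<noteq> 0"
proof
  define v where "v = (\<lambda>n. case n of 0 \<Rightarrow> 0 | Suc m \<Rightarrow> of_real (\<tau> m) * a (Suc m))"
  define F where "F = V_op lam f"
  define q where "q = (\<lambda>n. cis \<phi> * (of_real ((1 + \<mu> * real n) * (1 + \<nu> * real n)) * a (Suc n) - (if n = 0 then of_real \<beta> else 0)))"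
  define k where "k = (\<lambda>n. (1 + c * of_nat n) * of_real (integral {0..1} (\<lambda>t. \<omega> t * t ^ n)))"
  define c0 where "c0 = integral {0..1} (\<lambda>t. lam t * q_fun \<mu> \<nu> \<delta> t)"
  assume zero: "deriv (V_op lam f) z + c * (z * deriv (deriv (V_op lam f)) z) = 0"
  have F: "(\<lambda>n. v n * w ^ n) sums F w" if "norm w < 1" for w
    unfolding v_def F_def by (rule V_op_sums[OF f a0 that])
  have one: "(\<lambda>n. (if n = 0 then x else 0) * w ^ n) sums x" for x w :: complex
    using sums_single[of 0 "\<lambda>_. x"] by (rule sums_cong[THEN iffD1, rotated]) simp
  have Q: "(\<lambda>n. q n * w ^ n) sums (cis \<phi> * (H w - of_real \<beta>))" if "norm w < 1" for w
    using sums_mult[OF sums_diff[OF H[OF that] one[of "of_real \<beta>" w]], of "cis \<phi>"]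
    by (simp only: q_def left_diff_distrib mult.assoc)
  have K: "(\<lambda>n. k n * w ^ n) sums integral {0..1} (\<lambda>t. \<omega> t *\<^sub>R conv_kernel c (of_real t * w))" if "norm w < 1" for w
    unfolding k_def by (rule \<omega>_kernel_sums[OF that])
  have Kgt: "Re (integral {0..1} (\<lambda>t. \<omega> t *\<^sub>R conv_kernel c (of_real t * w))) > c0" if "norm w < 1" for w
    unfolding c0_def q_integral c by (rule Re_\<omega>_kernel_gt[OF that \<epsilon>])
  have k0: "k 0 = 1" unfolding k_def integral_unique[OF \<omega>_moment] by simp
  \<comment> \<open>The denominator of the \<open>\<omega>\<close> moment cancels the multiplier of
    H, leaving the n-th term of F' + c z F''; \<beta> affects n = 0 only, where \<open>k 0\<close> =
    1.\<close>
  have qk: "q n * k n * z ^ n = cis \<phi> * ((of_nat (Suc n) * v (Suc n) * z ^ n + c * (of_nat n * of_nat (Suc n) * v (Suc n) * z ^ n)) - (if n = 0 then of_real \<beta> else 0) * z ^ n)" for n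
  proof (cases "n = 0")
    case True
    then show ?thesis using k0 by (simp add: q_def v_def)
  next
    case False
    define N where "N = (1 + \<mu> * real n) * (1 + \<nu> * real n)"
    have "N > 0" unfolding N_def using \<mu> \<nu> by (intro mult_pos_pos add_pos_nonneg) auto
    then have NN: "of_real N * of_real (real (Suc n) * \<tau> n / N) = (of_nat (Suc n) * of_real (\<tau> n) :: complex)"
      by simp
    have q: "q n = cis \<phi> * (of_real N * a (Suc n))"
      unfolding q_def N_def using False by simp
    have k: "k n = (1 + c * of_nat n) * of_real (real (Suc n) * \<tau> n / N)"
      unfolding k_def N_def integral_unique[OF \<omega>_moment] ..
    have v: "v (Suc n) = of_real (\<tau> n) * a (Suc n)" by (simp add: v_def)
    have alg: "(1 + c * m) * A * (S * T) * Z = S * (T * A) * Z + c * (m * S * (T * A) * Z)" for m A S T Z :: complex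
      by (simp add: algebra_simps)
    have "q n * k n * z ^ n = cis \<phi> * ((1 + c * of_nat n) * a (Suc n) * (of_nat (Suc n) * of_real (\<tau> n)) * z ^ n)"
      unfolding q k NN[symmetric] by (simp only: mult_ac)
    also have "\<dots> = cis \<phi> * (of_nat (Suc n) * v (Suc n) * z ^ n + c * (of_nat n * of_nat (Suc n) * v (Suc n) * z ^ n))"
      unfolding v alg ..
    finally show ?thesis using False by simp
  qed
  have "(\<lambda>n. q n * k n * z ^ n) sums (cis \<phi> * ((deriv F z + c * (z * deriv (deriv F) z)) - of_real \<beta>))"
    unfolding qk by (intro sums_mult sums_diff sums_add one power_series_derivs[OF F] z)
  then have L: "(\<lambda>n. q n * k n * z ^ n) sums (cis \<phi> * (- of_real \<beta>))"
    using zero by (simp add: F_def)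
  have "Re (cis \<phi> * (- of_real \<beta>)) + Re (q 0) > 2 * c0 * Re (q 0)"
    by (rule Re_hadamard_product_gt[OF Q K Hpos Kgt k0 z L])
  moreover have "q 0 = cis \<phi> * of_real (1 - \<beta>)" using a1 by (simp add: q_def)
  moreover have "2 * c0 * ((1 - \<beta>) * cos \<phi>) = (1 - 2 * \<beta>) * cos \<phi>"
  proof -
    have "c0 = (1/2 - \<beta>) / (1 - \<beta>)"
      using \<beta>(2) unfolding c0_def[symmetric] by (simp add: diff_divide_distrib)
    then have "c0 * (1 - \<beta>) = 1/2 - \<beta>" using \<beta>(1) by simp
    moreover have "2 * c0 * ((1 - \<beta>) * cos \<phi>) = 2 * (c0 * (1 - \<beta>)) * cos \<phi>" by simp
    ultimately show ?thesis by simp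
  qed
  ultimately show False by (simp add: algebra_simps)
qed

end

theorem theorem4p1:
  fixes \<alpha> \<gamma> \<mu> \<nu> \<delta> \<beta> :: real and lam :: "real \<Rightarrow> real" and f :: "complex \<Rightarrow> complex"
  assumes "\<gamma> > 0" and "\<alpha> \<ge> 0"
    and "\<mu> > 0" and "\<nu> > 0" and "\<mu> + \<nu> = \<alpha> - \<gamma>" and "\<mu> * \<nu> = \<gamma>" and "\<mu> \<ge> 1"
    and "0 \<le> \<delta>" and "\<delta> \<le> 1/2"
    and "\<forall>t\<in>{0..1}. lam t \<ge> 0" and "lam integrable_on {0..1}" and "integral {0..1} lam = 1"
    and "Lambda_nu \<nu> lam integrable_on {0..1}" and "\<forall>t\<in>{0<..<1}. Lambda_nu \<nu> lam t > 0"
    and "Pi_mu_nu \<mu> \<nu> lam integrable_on {0..1}" and "\<forall>t\<in>{0<..<1}. Pi_mu_nu \<mu> \<nu> lam t > 0"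
    and "((\<lambda>t. t powr (1 / \<nu>) * Lambda_nu \<nu> lam t) \<longlongrightarrow> 0) (at_right 0)"
    and "((\<lambda>t. t powr (1 / \<nu>) * Pi_mu_nu \<mu> \<nu> lam t) \<longlongrightarrow> 0) (at_right 0)"
    and "\<forall>s t. 0 < s \<longrightarrow> s \<le> t \<longrightarrow> t < 1 \<longrightarrow>
           (- t * deriv (Pi_mu_nu \<mu> \<nu> lam) t + (1 - 1 / \<mu>) * Pi_mu_nu \<mu> \<nu> lam t)
             / ((1 + t) * (1 - t) powr (1 + 2 * \<delta>))
           \<le> (- s * deriv (Pi_mu_nu \<mu> \<nu> lam) s + (1 - 1 / \<mu>) * Pi_mu_nu \<mu> \<nu> lam s)
             / ((1 + s) * (1 - s) powr (1 + 2 * \<delta>))"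
    and "\<beta> < 1"
    and "(\<beta> - 1/2) / (1 - \<beta>) = - integral {0..1} (\<lambda>t. lam t * q_fun \<mu> \<nu> \<delta> t)"
    and "f \<in> class_W \<beta> \<alpha> \<gamma>"
  shows "V_op lam f \<in> class_K \<delta>"
proof -
  have \<Lambda>_pos: "Lambda_nu \<nu> lam t > 0" and \<Pi>_pos: "Pi_mu_nu \<mu> \<nu> lam t > 0" if "0 < t" "t < 1" for t
    using assms(14,16) that by simp_all
  interpret conv_weight \<mu> \<nu> \<delta> lam
    by (rule conv_weight.intro[OF assms(7,4,8,9) assms(10)[rule_format] assms(11,12) \<Lambda>_pos \<Pi>_pos assms(19)[rule_format]])
  define a where "a = (\<lambda>n. (deriv ^^ n) f 0 / fact n)"
  define F where "F = V_op lam f"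
  define v where "v = (\<lambda>n. case n of 0 \<Rightarrow> 0 | Suc m \<Rightarrow> of_real (\<tau> m) * a (Suc m))"
  obtain \<phi> where hol: "f holomorphic_on ball 0 1" and f0: "f 0 = 0" and f1: "deriv f 0 = 1"
    and pos: "\<forall>w\<in>ball 0 1. Re (cis \<phi> * (of_real (1 - \<alpha> + 2*\<gamma>) * quot_z f w + of_real (\<alpha> - 2*\<gamma>) * deriv f w
                  + of_real \<gamma> * w * deriv (deriv f) w - of_real \<beta>)) > 0"
    using assms(22) unfolding class_W_def class_A_def unit_disc_def by blast
  have f: "(\<lambda>n. a n * w ^ n) sums f w" if "norm w < 1" for w
    using holomorphic_power_series[OF hol, of w] that by (simp add: a_def)
  have a0: "a 0 = 0" and a1: "a 1 = 1" using f0 f1 by (simp_all add: a_def)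
  have quot: "(\<lambda>n. a (Suc n) * w ^ n) sums quot_z f w" if "norm w < 1" for w
  proof (cases "w = 0")
    case True
    then show ?thesis using powser_sums_zero[of "\<lambda>n. a (Suc n)"] a1 f1 by (simp add: quot_z_def)
  next
    case False
    have "(\<lambda>n. a (Suc n) * w ^ Suc n) sums f w"
      using f[OF that] sums_Suc_iff[of "\<lambda>n. a n * w ^ n"] a0 by simp
    from sums_divide[OF this, of w] show ?thesis using False by (simp add: quot_z_def)
  qed
  define H where "H = (\<lambda>w. of_real (1 - \<alpha> + 2*\<gamma>) * quot_z f w + of_real (\<alpha> - 2*\<gamma>) * deriv f w
                  + of_real \<gamma> * (w * deriv (deriv f) w))"
  have \<alpha>: "\<alpha> = \<mu> + \<nu> + \<mu> * \<nu>" and \<gamma>: "\<gamma> = \<mu> * \<nu>" using assms(5,6) by simp_all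
  have H: "(\<lambda>n. of_real ((1 + \<mu> * real n) * (1 + \<nu> * real n)) * a (Suc n) * w ^ n) sums H w" if "norm w < 1" for w
  proof -
    have "(\<lambda>n. of_real (1 - \<alpha> + 2*\<gamma>) * (a (Suc n) * w ^ n) + of_real (\<alpha> - 2*\<gamma>) * (of_nat (Suc n) * a (Suc n) * w ^ n)
        + of_real \<gamma> * (of_nat n * of_nat (Suc n) * a (Suc n) * w ^ n)) sums H w"
      unfolding H_def by (intro sums_add sums_mult quot power_series_derivs[OF f] that)
    \<comment> \<open>The multiplier is 1 + (\<alpha> - \<gamma>) n + \<gamma> n^2, and \<mu>, \<nu>
      are exactly the numbers that factor it.\<close>
    also have "(\<lambda>n. of_real (1 - \<alpha> + 2*\<gamma>) * (a (Suc n) * w ^ n) + of_real (\<alpha> - 2*\<gamma>) * (of_nat (Suc n) * a (Suc n) * w ^ n)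
        + of_real \<gamma> * (of_nat n * of_nat (Suc n) * a (Suc n) * w ^ n))
      = (\<lambda>n. of_real ((1 + \<mu> * real n) * (1 + \<nu> * real n)) * a (Suc n) * w ^ n)"
      unfolding \<alpha> \<gamma> by (rule ext) (simp add: algebra_simps)
    finally show ?thesis .
  qed
  have Hpos: "Re (cis \<phi> * (H w - of_real \<beta>)) > 0" if "norm w < 1" for w
    using pos[rule_format, of w] that unfolding H_def by (simp only: mult.assoc mem_ball_0)
  have nz: "deriv F z + c * (z * deriv (deriv F) z) \<noteq> 0"
    if "norm z < 1" "norm \<epsilon> \<le> 1" "c = (1 + \<epsilon>) / of_real (2 * (1 - \<delta>))" for z c \<epsilon>
    unfolding F_def by (rule V_op_combination_nonzero[OF f a0 a1 H Hpos assms(20,21) that])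
  have Fs: "(\<lambda>n. v n * w ^ n) sums F w" if "norm w < 1" for w
    unfolding v_def F_def by (rule V_op_sums[OF f a0 that])
  have "F holomorphic_on ball 0 1" by (rule power_series_derivs(1)[OF Fs])
  moreover have "F 0 = 0"
    using sums_unique2[OF Fs[of 0] powser_sums_zero[of v]] by (simp add: v_def)
  moreover have "deriv F 0 = 1"
    using sums_unique2[OF power_series_derivs(2)[OF Fs, of 0] powser_sums_zero[of "\<lambda>n. of_nat (Suc n) * v (Suc n)"]] a1
    by (simp add: v_def)
  moreover have "deriv F z \<noteq> 0" "Re (1 + z * deriv (deriv F) z / deriv F z) > \<delta>" if z: "norm z < 1" for z
  proof -
    \<comment> \<open>The choice \<epsilon> = -1 makes c = 0.\<close>
    show d: "deriv F z \<noteq> 0" using nz[OF z, of "- 1" 0] by simp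
    define W where "W = z * deriv (deriv F) z / deriv F z"
    show "Re (1 + z * deriv (deriv F) z / deriv F z) > \<delta>"
    proof (rule ccontr)
      assume "\<not> ?thesis"
      then have W: "Re (- W) \<ge> 1 - \<delta>" by (simp add: W_def)
      then have W0: "W \<noteq> 0" using \<delta> by auto
      \<comment> \<open>The solution of c = -1/W, for which F' + c z F'' = F' (1 + c W)
        vanishes.\<close>
      define \<epsilon> where "\<epsilon> = of_real (2 * (1 - \<delta>)) / (- W) - 1"
      have eq: "\<epsilon> = (of_real (2 * (1 - \<delta>)) + W) / (- W)" using W0 by (simp add: \<epsilon>_def add_divide_distrib)
      \<comment> \<open>The line Re W = -(1 - \<delta>) is the perpendicular bisector of 0 and -2 (1
        - \<delta>); the negated claim puts W on the far side from 0, which is |\<epsilon>| \<le>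
        1.\<close>
      have "(norm (of_real (2 * (1 - \<delta>)) + W))\<^sup>2 = (norm W)\<^sup>2 + 4 * (1 - \<delta>) * ((1 - \<delta>) - Re (- W))"
        unfolding cmod_power2 by (simp add: power2_eq_square algebra_simps)
      also have "\<dots> \<le> (norm W)\<^sup>2"
        using W \<delta> by (simp add: mult_nonneg_nonpos)
      finally have "norm (of_real (2 * (1 - \<delta>)) + W) \<le> norm W"
        by (rule power2_le_imp_le) simp
      then have "norm \<epsilon> \<le> 1" unfolding eq norm_divide using W0 by simp
      moreover have "1 / (- W) = (1 + \<epsilon>) / of_real (2 * (1 - \<delta>))"
        using \<delta> by (simp add: \<epsilon>_def)
      ultimately have "deriv F z + 1 / (- W) * (z * deriv (deriv F) z) \<noteq> 0" by (rule nz[OF z])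
      moreover have "z * deriv (deriv F) z = W * deriv F z" using d by (simp add: W_def)
      ultimately show False using W0 by simp
    qed
  qed
  ultimately show ?thesis
    unfolding class_K_def class_A_def F_def by (auto simp: unit_disc_def)
qed

end
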